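(* The globular theory $\Theta_w$ associated to the free weak $\omega$-category monad $\mathrm{fc}^w$ is homogeneous: every morphism of $\Theta_w$ factors uniquely as $i\,c$ with $i$ an immersion and $c$ a cover (homogeneous morphism).
   Context: **Globular sets and Batanin trees.** A globular set $X$ consists of sets $X_n$ ($n\in\mathbb N$) and maps $\mathrm{src},\mathrm{tgt}:X_{n+1}\to X_n$ with $\mathrm{src}\,\mathrm{src}=\mathrm{src}\,\mathrm{tgt}$, $\mathrm{tgt}\,\mathrm{src}=\mathrm{tgt}\,\mathrm{tgt}$; $\mathsf{Glob}$ is their category, i.e. presheaves on a category $\mathbb G$ with objects $[n]$. The set of Batanin trees is inductively generated by: for every finite (possibly empty) list $[B_1,\dots,B_m]$ of trees, a tree $\mathrm{br}[B_1,\dots,B_m]$. $\dim\mathrm{br}[\,]=0$ and otherwise $\dim\mathrm{br}[B_1,\dots,B_m]=1+\max_i\dim B_i$. The globular set $\mathrm{Pos}(B)$ of positions is inductively generated by: $\mathrm{init}\in\mathrm{Pos}_0(B)$ for every $B$; $\mathrm{inr}(p)\in\mathrm{Pos}_n(\mathrm{br}[B,B_1,\dots,B_m])$ for $p\in\mathrm{Pos}_n(\mathrm{br}[B_1,\dots,B_m])$; $\mathrm{inl}(q)\in\mathrm{Pos}_{n+1}(\mathrm{br}[B,B_1,\dots,B_m])$ for $q\in\mathrm{Pos}_n(B)$. Source and target: $\mathrm{src}(\mathrm{inr}\,p)=\mathrm{inr}(\mathrm{src}\,p)$, $\mathrm{tgt}(\mathrm{inr}\,p)=\mathrm{inr}(\mathrm{tgt}\,p)$;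 if $q$ has dimension $0$, $\mathrm{src}(\mathrm{inl}\,q)=\mathrm{init}$ and $\mathrm{tgt}(\mathrm{inl}\,q)=\mathrm{inr}(\mathrm{init})$; otherwise $\mathrm{src}(\mathrm{inl}\,q)=\mathrm{inl}(\mathrm{src}\,q)$, $\mathrm{tgt}(\mathrm{inl}\,q)=\mathrm{inl}(\mathrm{tgt}\,q)$. We write $B$ for $\mathrm{Pos}(B)$. A position $p\in\mathrm{Pos}_n(B)$ is source (resp. target) boundary if it is not the target (resp. source) of any $(n+1)$-position; $\partial^s_n(B)$, $\partial^t_n(B)$ are the sets of source, target boundary $n$-positions. Globes: $D_0=\mathrm{br}[\,]$, $D_{n+1}=\mathrm{br}[D_n]$; $\mathrm{Pos}(D_n)\cong\mathbb G(-,[n])$. **Computads.** By induction on $n$ one defines categories $\mathsf{Comp}_n$, functors $u_n:\mathsf{Comp}_n\to\mathsf{Comp}_{n-1}$ and $\mathrm{Cell}_n,\mathrm{Sphere}_n:\mathsf{Comp}_n\to\mathsf{Set}$, a natural transformation $\mathrm{bdry}_n:\mathrm{Cell}_n\Rightarrow\mathrm{Sphere}_{n-1}u_n$, and, for globular sets $X$, computads $\mathrm{Free}_nX$ and spheres $\mathrm{ps}_{n,X}(a,b)\in\mathrm{Sphere}_n(\mathrm{Free}_nX)$ for $a,b\in X_n$ with common source and target. $\mathsf{Comp}_{-1}$ is the terminal category and $\mathrm{Sphere}_{-1}$ is a singleton. *$n=0$:* $\mathsf{Comp}_0=\mathsf{Set}$, $\mathrm{Cell}_0=\mathrm{id}$,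 $\mathrm{Sphere}_0(C)=C\times C$, $\mathrm{Free}_0X=X_0$, $\mathrm{ps}_{0,X}(a,b)=(a,b)$, $\mathrm{supp}(c)=\{c\}$; a $0$-sphere $(a,b)$ of $\mathrm{Free}_0B$ is full iff $a$ is source boundary and $b$ is target boundary. *$n>0$:* an $n$-computad is $C=(C_{n-1},V_n^C,\phi_n^C)$ with $C_{n-1}\in\mathsf{Comp}_{n-1}$, a set $V_n^C$ of generators and $\phi_n^C:V_n^C\to\mathrm{Sphere}_{n-1}(C_{n-1})$. $\mathrm{Free}_nX=(\mathrm{Free}_{n-1}X,X_n,x\mapsto\mathrm{ps}_{n-1,X}(\mathrm{src}\,x,\mathrm{tgt}\,x))$. Mutually inductively: a homomorphism $\sigma:D\to C$ is a pair of $\sigma_{n-1}:D_{n-1}\to C_{n-1}$ and $\sigma_V:V_n^D\to\mathrm{Cell}_n(C)$ with $\mathrm{bdry}_n\sigma_V=\mathrm{Sphere}_{n-1}(\sigma_{n-1})\phi_n^D$; $\mathrm{Cell}_n(C)$ is generated by $\mathrm{var}\,v$ for $v\in V_n^C$ and $\mathrm{coh}(B,A,\tau)$ for $B$ a Batanin tree with $\dim B\le n$, $A$ a full sphere in $\mathrm{Sphere}_{n-1}(\mathrm{Free}_{n-1}B)$ and $\tau:\mathrm{Free}_nB\to C$ a homomorphism; $\mathrm{bdry}_n(\mathrm{var}\,v)=\phi_n^C(v)$, $\mathrm{bdry}_n(\mathrm{coh}(B,A,\tau))=\mathrm{Sphere}_{n-1}(\tau_{n-1})(A)$. Action and composition: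 $\mathrm{Cell}_n(\sigma)(\mathrm{var}\,v)=\sigma_V(v)$, $\mathrm{Cell}_n(\sigma)(\mathrm{coh}(B,A,\tau))=\mathrm{coh}(B,A,\sigma\circ\tau)$, $\sigma\circ\tau=(\sigma_{n-1}\circ\tau_{n-1},\mathrm{Cell}_n(\sigma)\circ\tau_V)$. $\mathrm{Sphere}_n(C)$ is the set of triples $(A,a,b)$ with $a,b\in\mathrm{Cell}_n(C)$, $\mathrm{bdry}_n a=\mathrm{bdry}_n b=A$; $\mathrm{pr}_1,\mathrm{pr}_2$ pick $a,b$. $\mathrm{ps}_{n,X}(p,q)=(\mathrm{ps}_{n-1,X}(\mathrm{src}\,p,\mathrm{tgt}\,p),\mathrm{var}\,p,\mathrm{var}\,q)$. $\mathrm{supp}(\mathrm{var}\,v)=\{v\}$, $\mathrm{supp}(\mathrm{coh}(B,A,\tau))=\bigcup_{p\in\mathrm{Pos}_n(B)}\mathrm{supp}(\tau_V(p))$. $(A,a,b)\in\mathrm{Sphere}_n(\mathrm{Free}_nB)$ is full iff $A$ is full, $\mathrm{supp}(a)=\partial_n^s(B)$ and $\mathrm{supp}(b)=\partial_n^t(B)$. $\mathsf{Comp}$ is the limit of the $u_n$; its objects $C=(C_n)_n$ are computads. For $0$-cells $\mathrm{var}\,x$ means $x$. $\mathrm{Free}:\mathsf{Glob}\to\mathsf{Comp}$ sends $X$ to $(\mathrm{Free}_nX)_n$ and $f$ to $x\mapsto\mathrm{var}\,f(x)$; it is left adjoint to the functor $\mathrm{Cell}$ sending $C$ to its globular set of cells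 ($\mathrm{src}=\mathrm{pr}_1\mathrm{bdry}$, $\mathrm{tgt}=\mathrm{pr}_2\mathrm{bdry}$), and $\mathrm{fc}^w=\mathrm{Cell}\circ\mathrm{Free}$ is the induced monad. **Globular theories.** $\Theta_0$ is the category with objects Batanin trees and $\Theta_0(B,B')=\mathsf{Glob}(\mathrm{Pos}\,B,\mathrm{Pos}\,B')$. For a category $F:\mathbb G\to\mathcal C$ under $\mathbb G$, a globular sum is a colimit of a zigzag $F[n_0]\xleftarrow{F(t)}F[m_1]\xrightarrow{F(s)}F[n_1]\leftarrow\cdots\rightarrow F[n_k]$, $s,t$ the (iterated) source and target inclusions. A globular theory is a category $\Theta_A$ with a bijective-on-objects faithful functor $j_A:\Theta_0\to\Theta_A$ preserving globular sums. Immersions in $\Theta_A$ are the morphisms of $\Theta_0$. A morphism $f$ is homogeneous (a cover) if $f=ig$ with $i$ an immersion implies $i=\mathrm{id}$. $\Theta_w$ is the globular theory with $\Theta_w(B,B')$ the set of $\mathrm{fc}^w$-algebra homomorphisms between the free algebras on $\mathrm{Pos}(B)$ and $\mathrm{Pos}(B')$, equivalently $\mathsf{Comp}(\mathrm{Free}\,B,\mathrm{Free}\,B')$, and $j_w$ induced by $\mathrm{Free}$. *)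

theory Defs
  imports "HOL-Library.FuncSet"
begin

section \<open>Globular sets\<close>

record 'a glob =
  cells :: "nat \<Rightarrow> 'a set"
  src :: "nat \<Rightarrow> 'a \<Rightarrow> 'a"  \<comment> \<open>\<open>src X n\<close> and \<open>tgt X n\<close> are maps from level \<open>Suc n\<close> to level \<open>n\<close>\<close>
  tgt :: "nat \<Rightarrow> 'a \<Rightarrow> 'a"

definition globular_set :: "'a glob \<Rightarrow> bool" where
  "globular_set X \<longleftrightarrow>
     (\<forall>n. src X n \<in> cells X (Suc n) \<rightarrow> cells X n \<and> tgt X n \<in> cells X (Suc n) \<rightarrow> cells X n) \<and>
     (\<forall>n. \<forall>x\<in>cells X (Suc (Suc n)).
        src X n (src X (Suc n) x) = src X n (tgt X (Suc n) x) \<and>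
        tgt X n (src X (Suc n) x) = tgt X n (tgt X (Suc n) x))"

definition glob_hom :: "'a glob \<Rightarrow> 'b glob \<Rightarrow> (nat \<Rightarrow> 'a \<Rightarrow> 'b) set" where
  "glob_hom X Y = {f. (\<forall>n. f n \<in> cells X n \<rightarrow>\<^sub>E cells Y n) \<and>
     (\<forall>n. \<forall>x\<in>cells X (Suc n).
        f n (src X n x) = src Y n (f (Suc n) x) \<and> f n (tgt X n x) = tgt Y n (f (Suc n) x))}"


section \<open>Batanin trees and their positions\<close>

datatype tree = Br "tree list"

primrec tdim :: "tree \<Rightarrow> nat" where
  "tdim (Br Bs) = (if Bs = [] then 0 else Suc (Max (set (map tdim Bs))))"

datatype pos = PInit | PInl pos | PInr pos

inductive is_pos :: "nat \<Rightarrow> tree \<Rightarrow> pos \<Rightarrow> bool" where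
  init: "is_pos 0 B PInit"
| inr: "is_pos n (Br Bs) p \<Longrightarrow> is_pos n (Br (B # Bs)) (PInr p)"
| inl: "is_pos n B q \<Longrightarrow> is_pos (Suc n) (Br (B # Bs)) (PInl q)"

primrec pdim :: "pos \<Rightarrow> nat" where
  "pdim PInit = 0"
| "pdim (PInr p) = pdim p"
| "pdim (PInl q) = Suc (pdim q)"

primrec psrc :: "pos \<Rightarrow> pos" where
  "psrc PInit = undefined"
| "psrc (PInr p) = PInr (psrc p)"
| "psrc (PInl q) = (if pdim q = 0 then PInit else PInl (psrc q))"

primrec ptgt :: "pos \<Rightarrow> pos" where
  "ptgt PInit = undefined"
| "ptgt (PInr p) = PInr (ptgt p)"
| "ptgt (PInl q) = (if pdim q = 0 then PInr PInit else PInl (ptgt q))"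

definition Pos :: "tree \<Rightarrow> pos glob" where
  "Pos B = \<lparr>cells = (\<lambda>n. {p. is_pos n B p}), src = (\<lambda>n. psrc), tgt = (\<lambda>n. ptgt)\<rparr>"

lemma is_pos_pdim: "is_pos n B p \<Longrightarrow> pdim p = n"
  by (induction rule: is_pos.induct) auto

lemma pos_src: "is_pos m B p \<Longrightarrow> m = Suc n \<Longrightarrow> is_pos n B (psrc p) \<and> is_pos n B (ptgt p)"
proof (induction arbitrary: n rule: is_pos.induct)
  case (inl m B q Bs)
  have "pdim q = m" using inl.hyps by (rule is_pos_pdim)
  with inl show ?case
    by (cases "m = 0") (auto simp: gr0_conv_Suc intro: is_pos.intros)
qed (auto intro: is_pos.intros)

lemma pos_glob: "is_pos m B p \<Longrightarrow> m = Suc (Suc n) \<Longrightarrow> psrc (psrc p) = psrc (ptgt p) \<and> ptgt (psrc p) = ptgt (ptgt p)"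
proof (induction arbitrary: n rule: is_pos.induct)
  case (inl m B q Bs)
  have a: "pdim q = Suc n" "is_pos n B (psrc q)" "is_pos n B (ptgt q)"
    using inl is_pos_pdim pos_src[of m B q n] by auto
  then have "pdim (psrc q) = n" "pdim (ptgt q) = n" using is_pos_pdim by auto
  with a inl show ?case by (cases n) auto
qed auto

lemma globular_set_Pos: "globular_set (Pos B)"
  unfolding globular_set_def Pos_def using pos_src pos_glob by auto

definition src_bdry :: "nat \<Rightarrow> tree \<Rightarrow> pos set" where
  "src_bdry n B = {p \<in> cells (Pos B) n. \<forall>q\<in>cells (Pos B) (Suc n). tgt (Pos B) n q \<noteq> p}"

definition tgt_bdry :: "nat \<Rightarrow> tree \<Rightarrow> pos set" where
  "tgt_bdry n B = {p \<in> cells (Pos B) n. \<forall>q\<in>cells (Pos B) (Suc n). src (Pos B) n q \<noteq> p}"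


section \<open>Computads\<close>

text \<open>
  A sphere of dimension \<open>n\<close> is a triple of a sphere of dimension \<open>n - 1\<close> and two cells of
  dimension \<open>n\<close>; \<open>Point\<close> is the unique sphere of dimension \<open>-1\<close>. Thus a \<open>0\<close>-sphere \<open>(a, b)\<close>
  is \<open>Sph Point a b\<close>, and the dimension of a sphere is \<open>height - 1\<close>.

  A homomorphism is the family of its maps on generators, in each dimension. In
  \<open>Coh B A \<tau>\<close>, the sphere \<open>A\<close> has cells over the positions of \<open>B\<close>, whereas \<open>\<tau>\<close> has cells of
  the ambient computad as values. A HOL datatype cannot change its type of generators under
  recursion, so the generators of all computads are drawn from the type of positions. This
  universe contains every free computad on a Batanin tree.
\<close>

datatype 'c sphere = Point | Sph "'c sphere" 'c 'c

primrec height :: "'c sphere \<Rightarrow> nat" where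
  "height Point = 0"
| "height (Sph A a b) = Suc (height A)"

datatype cell = Var pos | Coh tree "cell sphere" "nat \<Rightarrow> pos \<Rightarrow> cell"

type_synonym chom = "nat \<Rightarrow> pos \<Rightarrow> cell"

text \<open>
  The map \<open>attach C n\<close> takes the generators of dimension \<open>n\<close> to \<open>(n - 1)\<close>-spheres; it
  is only relevant for \<open>n > 0\<close>. The \<open>n\<close>-computad underlying \<open>C\<close> consists of the data in
  dimensions at most \<open>n\<close>, so such a record is a compatible family of \<open>n\<close>-computads.
\<close>

record computad =
  gens :: "nat \<Rightarrow> pos set"
  attach :: "nat \<Rightarrow> pos \<Rightarrow> cell sphere"

text \<open>
  \<open>act \<sigma> n\<close> is the action of \<open>\<sigma>\<close> on \<open>n\<close>-cells. Homomorphisms are represented extensionally,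
  i.e. they are \<open>undefined\<close> outside their domain, so that their equality is the intended one.
\<close>

primrec act :: "chom \<Rightarrow> nat \<Rightarrow> cell \<Rightarrow> cell" where
  "act \<sigma> n (Var v) = \<sigma> n v"
| "act \<sigma> n (Coh B A \<tau>) =
     Coh B A (\<lambda>k p. if k \<le> n \<and> p \<in> cells (Pos B) k then act \<sigma> k (\<tau> k p) else undefined)"

primrec sphere_act :: "chom \<Rightarrow> cell sphere \<Rightarrow> cell sphere" where
  "sphere_act \<sigma> Point = Point"
| "sphere_act \<sigma> (Sph A a b) = Sph (sphere_act \<sigma> A) (act \<sigma> (height A) a) (act \<sigma> (height A) b)"

fun bdry :: "computad \<Rightarrow> nat \<Rightarrow> cell \<Rightarrow> cell sphere" where
  "bdry C 0 c = Point"
| "bdry C (Suc n) (Var v) = attach C (Suc n) v"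
| "bdry C (Suc n) (Coh B A \<tau>) = sphere_act \<tau> A"

primrec supp :: "nat \<Rightarrow> cell \<Rightarrow> pos set" where
  "supp n (Var v) = {v}"
| "supp n (Coh B A \<tau>) = (\<Union>p\<in>cells (Pos B) n. supp n (\<tau> n p))"

primrec ps :: "pos glob \<Rightarrow> nat \<Rightarrow> pos \<Rightarrow> pos \<Rightarrow> cell sphere" where
  "ps X 0 p q = Sph Point (Var p) (Var q)"
| "ps X (Suc n) p q = Sph (ps X n (src X n p) (tgt X n p)) (Var p) (Var q)"

definition Free :: "pos glob \<Rightarrow> computad" where
  "Free X = \<lparr>gens = cells X,
     attach = (\<lambda>n x. case n of 0 \<Rightarrow> Point | Suc k \<Rightarrow> ps X k (src X k x) (tgt X k x))\<rparr>"

text \<open>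
  \<open>is_nhom n D C \<sigma>\<close>: \<open>\<sigma>\<close> is a homomorphism between the \<open>n\<close>-computads underlying \<open>D\<close> and \<open>C\<close>.
  \<open>is_cell C n c\<close>: \<open>c\<close> is an \<open>n\<close>-cell of \<open>C\<close>.
  \<open>is_full n B S\<close>: \<open>S\<close> is a full \<open>n\<close>-sphere of the free computad on \<open>B\<close>.
\<close>

inductive is_cell :: "computad \<Rightarrow> nat \<Rightarrow> cell \<Rightarrow> bool"
  and is_nhom :: "nat \<Rightarrow> computad \<Rightarrow> computad \<Rightarrow> chom \<Rightarrow> bool"
  and is_full :: "nat \<Rightarrow> tree \<Rightarrow> cell sphere \<Rightarrow> bool"
where
  var: "v \<in> gens C n \<Longrightarrow> is_cell C n (Var v)"
| coh: "\<lbrakk>tdim B \<le> Suc n; is_full n B A; is_nhom (Suc n) (Free (Pos B)) C \<tau>\<rbrakk>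
    \<Longrightarrow> is_cell C (Suc n) (Coh B A \<tau>)"
| nhom: "\<lbrakk>\<And>k v. k \<le> n \<Longrightarrow> v \<in> gens D k \<Longrightarrow> is_cell C k (\<sigma> k v);
     \<And>k v. Suc k \<le> n \<Longrightarrow> v \<in> gens D (Suc k) \<Longrightarrow>
       bdry C (Suc k) (\<sigma> (Suc k) v) = sphere_act \<sigma> (attach D (Suc k) v);
     \<And>k v. k > n \<or> v \<notin> gens D k \<Longrightarrow> \<sigma> k v = undefined\<rbrakk>
    \<Longrightarrow> is_nhom n D C \<sigma>"
| full_0: "\<lbrakk>p \<in> src_bdry 0 B; q \<in> tgt_bdry 0 B\<rbrakk> \<Longrightarrow> is_full 0 B (Sph Point (Var p) (Var q))"
| full_Suc: "\<lbrakk>is_full n B A;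
     is_cell (Free (Pos B)) (Suc n) a; bdry (Free (Pos B)) (Suc n) a = A;
     is_cell (Free (Pos B)) (Suc n) b; bdry (Free (Pos B)) (Suc n) b = A;
     supp (Suc n) a = src_bdry (Suc n) B; supp (Suc n) b = tgt_bdry (Suc n) B\<rbrakk>
    \<Longrightarrow> is_full (Suc n) B (Sph A a b)"

definition Cell :: "nat \<Rightarrow> computad \<Rightarrow> cell set" where
  "Cell n C = {c. is_cell C n c}"

definition Sphere :: "nat \<Rightarrow> computad \<Rightarrow> cell sphere set" where
  "Sphere n C = {Sph A a b | A a b. a \<in> Cell n C \<and> b \<in> Cell n C \<and> bdry C n a = A \<and> bdry C n b = A}"

definition computad :: "computad \<Rightarrow> bool" where
  "computad C \<longleftrightarrow> (\<forall>n. attach C (Suc n) \<in> gens C (Suc n) \<rightarrow> Sphere n C)"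


lemma ps_Sphere:
  assumes "globular_set X"
  shows "p \<in> cells X n \<Longrightarrow> q \<in> cells X n \<Longrightarrow> (\<And>k. n = Suc k \<Longrightarrow> src X k p = src X k q \<and> tgt X k p = tgt X k q)
   \<Longrightarrow> ps X n p q \<in> Sphere n (Free X)"
  by (cases n) (auto simp: Sphere_def Cell_def Free_def intro!: is_cell_is_nhom_is_full.intros)

lemma computad_Free: assumes "globular_set X" shows "computad (Free X)"
  unfolding computad_def
proof (intro allI funcsetI)
  fix n x assume "x \<in> gens (Free X) (Suc n)"
  then have x: "x \<in> cells X (Suc n)" by (simp add: Free_def)
  have "ps X n (src X n x) (tgt X n x) \<in> Sphere n (Free X)"
    using assms x by (intro ps_Sphere) (auto simp: globular_set_def Pi_def)
  then show "attach (Free X) (Suc n) x \<in> Sphere n (Free X)" by (simp add: Free_def)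
qed


subsection \<open>The category of computads\<close>

definition trunc :: "nat \<Rightarrow> chom \<Rightarrow> chom" where
  "trunc n \<sigma> = (\<lambda>k. if k \<le> n then \<sigma> k else (\<lambda>_. undefined))"

text \<open>Homomorphisms of computads are compatible families of homomorphisms of \<open>n\<close>-computads.\<close>

definition comp_hom :: "computad \<Rightarrow> computad \<Rightarrow> chom set" where
  "comp_hom D C = {\<sigma>. \<forall>n. is_nhom n D C (trunc n \<sigma>)}"

definition comp_id :: "computad \<Rightarrow> chom" where
  "comp_id C = (\<lambda>n. \<lambda>v\<in>gens C n. Var v)"

definition comp_compose :: "computad \<Rightarrow> chom \<Rightarrow> chom \<Rightarrow> chom" where
  "comp_compose D \<sigma> \<tau> = (\<lambda>n. \<lambda>v\<in>gens D n. act \<sigma> n (\<tau> n v))"  \<comment> \<open>\<open>D\<close> is the domain of \<open>\<tau>\<close>\<close>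

definition Free_map :: "pos glob \<Rightarrow> (nat \<Rightarrow> pos \<Rightarrow> pos) \<Rightarrow> chom" where
  "Free_map X f = (\<lambda>n. \<lambda>x\<in>cells X n. Var (f n x))"


section \<open>Categories under the category of Batanin trees\<close>

definition Theta0 :: "tree \<Rightarrow> tree \<Rightarrow> (nat \<Rightarrow> pos \<Rightarrow> pos) set" where
  "Theta0 B B' = glob_hom (Pos B) (Pos B')"

text \<open>
  A category with Batanin trees as objects together with the action \<open>incl\<close> on morphisms of an
  identity-on-objects functor from \<^const>\<open>Theta0\<close>. Composition \<open>cmp B D B' g f\<close> is \<open>g \<circ> f\<close> for
  \<open>f\<close> from \<open>B\<close> to \<open>D\<close> and \<open>g\<close> from \<open>D\<close> to \<open>B'\<close>.
\<close>

record 'm tree_category =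
  hom :: "tree \<Rightarrow> tree \<Rightarrow> 'm set"
  idm :: "tree \<Rightarrow> 'm"
  cmp :: "tree \<Rightarrow> tree \<Rightarrow> tree \<Rightarrow> 'm \<Rightarrow> 'm \<Rightarrow> 'm"
  incl :: "tree \<Rightarrow> tree \<Rightarrow> (nat \<Rightarrow> pos \<Rightarrow> pos) \<Rightarrow> 'm"

definition immersion :: "'m tree_category \<Rightarrow> tree \<Rightarrow> tree \<Rightarrow> 'm \<Rightarrow> bool" where
  "immersion T B B' i \<longleftrightarrow> i \<in> incl T B B' ` Theta0 B B'"

definition cover :: "'m tree_category \<Rightarrow> tree \<Rightarrow> tree \<Rightarrow> 'm \<Rightarrow> bool" where
  "cover T B B' f \<longleftrightarrow> f \<in> hom T B B' \<and>
     (\<forall>D i g. immersion T D B' i \<longrightarrow> g \<in> hom T B D \<longrightarrow> f = cmp T B D B' i g \<longrightarrow>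
        D = B' \<and> i = idm T B')"

definition Theta_w :: "chom tree_category" where
  "Theta_w = \<lparr>
     hom = (\<lambda>B B'. comp_hom (Free (Pos B)) (Free (Pos B'))),
     idm = (\<lambda>B. comp_id (Free (Pos B))),
     cmp = (\<lambda>B D B' g f. comp_compose (Free (Pos B)) g f),
     incl = (\<lambda>B B' f. Free_map (Pos B) f)\<rparr>"

end

theory Submission
  imports Defs
begin

text \<open>
  An immersion into a tree \<open>B'\<close> is the same thing as a subtree of \<open>B'\<close>, so a factorisation of
  \<open>f : B \<rightarrow> B'\<close> through an immersion amounts to a subtree that contains all generators used by
  \<open>f\<close>, and the factorisation has a cover as its second factor exactly when that subtree is no
  larger than necessary. The theorem therefore reduces to one point: the set of generators that
  \<open>f\<close> uses, in all dimensions and closed under faces, is itself (the set of positions of) a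
  subtree of \<open>B'\<close>. Existence, uniqueness and the characterisation of covers follow formally.
  
  That point fails for arbitrary sets of positions and has to be extracted from the fullness
  condition on coherence cells. The subtrees of all trees form a strict \<open>\<omega>\<close>-category: a subtree
  has a source and a target boundary in each dimension, and subtrees with matching boundaries can
  be glued, the result being their union (\<open>positions_glue\<close>). So a diagram of subtrees that is
  indexed by the positions of a tree \<open>B\<close>, compatibly with faces, has a composite, and the
  boundaries of the composite are the composites over the boundaries of \<open>B\<close> (\<open>pasting\<close>). Now one
  shows by induction that the support of every cell is a subtree and that the support of its
  source and target are the boundaries of that subtree (\<open>cell_subtree\<close>). For a coherence cell
  \<open>Coh B A \<tau>\<close> the values of \<open>\<tau>\<close> form such a diagram by induction, and fullness of \<open>A\<close> says that its
  two top cells are supported exactly on the source and target boundary of \<open>B\<close>, so that the pasting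
  lemma computes the supports of their images under \<open>\<tau>\<close>.
  
  Subtrees are determined by their sets of positions (\<open>positions_inject\<close>), which gives uniqueness
  of the immersion. An immersion has a retraction on generators, and a cell whose support lies in
  the subtree can be pulled back along it (\<open>retract_cell\<close>); this gives the second factor and
  shows that immersions can be cancelled on the left.
\<close>

section \<open>Positions of a tree\<close>

text \<open>
  The positions of \<open>Br Bs\<close> are its vertices, numbered from \<open>0\<close> to the number of children, and, for
  each child \<open>i\<close>, the positions of that child raised by one dimension and placed between the
  vertices \<open>i\<close> and \<open>i + 1\<close>. Numbering them in this way replaces recursion along the list of children
  by arithmetic on indices.
\<close>

definition vertex :: "nat \<Rightarrow> pos" where
  "vertex i = (PInr ^^ i) PInit"

definition inner :: "nat \<Rightarrow> pos \<Rightarrow> pos" where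
  "inner i q = (PInr ^^ i) (PInl q)"

lemma vertex_simps: "vertex 0 = PInit" "vertex (Suc i) = PInr (vertex i)"
  by (simp_all add: vertex_def)

lemma inner_simps: "inner 0 q = PInl q" "inner (Suc i) q = PInr (inner i q)"
  by (simp_all add: inner_def)

lemma vertex_inject [simp]: "vertex i = vertex j \<longleftrightarrow> i = j"
proof (induction i arbitrary: j)
  case 0
  show ?case by (cases j) (auto simp: vertex_simps)
next
  case (Suc i)
  then show ?case by (cases j) (auto simp: vertex_simps)
qed

lemma inner_inject [simp]: "inner i q = inner j r \<longleftrightarrow> i = j \<and> q = r"
proof (induction i arbitrary: j)
  case 0
  show ?case by (cases j) (auto simp: inner_simps)
next
  case (Suc i)
  then show ?case by (cases j) (auto simp: inner_simps)
qed

lemma vertex_neq_inner [simp]: "vertex i \<noteq> inner j q" "inner j q \<noteq> vertex i"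
proof -
  show "vertex i \<noteq> inner j q"
  proof (induction i arbitrary: j)
    case 0
    show ?case by (cases j) (auto simp: vertex_simps inner_simps)
  next
    case (Suc i)
    then show ?case by (cases j) (auto simp: vertex_simps inner_simps)
  qed
  then show "inner j q \<noteq> vertex i" by metis
qed

lemma pos_vertex_inner_cases:
  obtains (vertex) i where "p = vertex i" | (inner) i q where "p = inner i q"
proof (induction p arbitrary: thesis)
  case PInit
  then show ?case using vertex_simps(1) by metis
next
  case (PInl q)
  then show ?case using inner_simps(1) by metis
next
  case (PInr p)
  then show ?case using vertex_simps(2) inner_simps(2) by metis
qed

lemma pos_vertex_inner_induct [case_names vertex inner]:
  assumes "\<And>i. P (vertex i)" "\<And>i q. P q \<Longrightarrow> P (inner i q)"
  shows "P p"
proof (induction "size p" arbitrary: p rule: less_induct)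
  case less
  have "size q < size (inner i q)" for i q
    by (induction i) (auto simp: inner_simps)
  with less assms show ?case by (cases p rule: pos_vertex_inner_cases) auto
qed

lemma pos_set_eqI:
  assumes "\<And>i. vertex i \<in> P \<longleftrightarrow> vertex i \<in> Q" "\<And>i q. inner i q \<in> P \<longleftrightarrow> inner i q \<in> Q"
  shows "P = Q"
proof (rule set_eqI)
  fix p show "p \<in> P \<longleftrightarrow> p \<in> Q"
    using assms by (cases p rule: pos_vertex_inner_cases) auto
qed

lemma pdim_vertex [simp]: "pdim (vertex i) = 0"
  by (induction i) (auto simp: vertex_simps)

lemma pdim_inner [simp]: "pdim (inner i q) = Suc (pdim q)"
  by (induction i) (auto simp: inner_simps)

lemma psrc_inner [simp]: "psrc (inner i q) = (if pdim q = 0 then vertex i else inner i (psrc q))"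
  by (induction i) (auto simp: inner_simps vertex_simps)

lemma ptgt_inner [simp]: "ptgt (inner i q) = (if pdim q = 0 then vertex (Suc i) else inner i (ptgt q))"
  by (induction i) (auto simp: inner_simps vertex_simps)

text \<open>
  The Boolean selects the source (\<open>True\<close>) or the target (\<open>False\<close>), here and below, so that dual
  statements have a common proof.
\<close>

definition face :: "bool \<Rightarrow> pos \<Rightarrow> pos" where
  "face e p = (if e then psrc p else ptgt p)"

lemma face_inner [simp]:
  "face e (inner i q) =
    (if pdim q = 0 then vertex (if e then i else Suc i) else inner i (face e q))"
  by (simp add: face_def)

lemma pdim_0_iff: "pdim p = 0 \<longleftrightarrow> (\<exists>i. p = vertex i)"
  by (cases p rule: pos_vertex_inner_cases) auto

lemma pdim_Suc_iff: "pdim p = Suc n \<longleftrightarrow> (\<exists>i q. p = inner i q \<and> pdim q = n)"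
  by (cases p rule: pos_vertex_inner_cases) auto

inductive_cases is_pos_PInrE: "is_pos n B (PInr p)"
inductive_cases is_pos_PInlE: "is_pos n B (PInl p)"
inductive_cases is_pos_PInitE: "is_pos n B PInit"

lemma is_pos_PInr_iff:
  "is_pos n (Br Bs) (PInr p) \<longleftrightarrow> (\<exists>B Bs'. Bs = B # Bs' \<and> is_pos n (Br Bs') p)"
  by (auto elim: is_pos_PInrE intro: is_pos.intros)

lemma is_pos_PInl_iff:
  "is_pos n (Br Bs) (PInl q) \<longleftrightarrow> (\<exists>B Bs' m. Bs = B # Bs' \<and> n = Suc m \<and> is_pos m B q)"
  by (auto elim: is_pos_PInlE intro: is_pos.intros)

lemma is_pos_PInit_iff [simp]: "is_pos n B PInit \<longleftrightarrow> n = 0"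
  by (auto elim: is_pos_PInitE intro: is_pos.intros)

lemma is_pos_vertex_iff: "is_pos n (Br Bs) (vertex i) \<longleftrightarrow> n = 0 \<and> i \<le> length Bs"
proof (induction i arbitrary: Bs)
  case 0
  show ?case by (simp add: vertex_simps)
next
  case (Suc i)
  then show ?case by (cases Bs) (auto simp: vertex_simps is_pos_PInr_iff)
qed

lemma is_pos_inner_iff:
  "is_pos n (Br Bs) (inner i q) \<longleftrightarrow> i < length Bs \<and> (\<exists>m. n = Suc m \<and> is_pos m (Bs ! i) q)"
proof (induction i arbitrary: Bs)
  case 0
  show ?case by (cases Bs) (auto simp: inner_simps is_pos_PInl_iff)
next
  case (Suc i)
  then show ?case by (cases Bs) (auto simp: inner_simps is_pos_PInr_iff)
qed

definition tree_positions :: "tree \<Rightarrow> pos set" where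
  "tree_positions B = {p. is_pos (pdim p) B p}"

lemma is_pos_iff: "is_pos n B p \<longleftrightarrow> p \<in> tree_positions B \<and> pdim p = n"
  using is_pos_pdim by (auto simp: tree_positions_def)

lemma vertex_in_tree_positions [simp]: "vertex i \<in> tree_positions (Br Bs) \<longleftrightarrow> i \<le> length Bs"
  by (simp add: tree_positions_def is_pos_vertex_iff)

lemma inner_in_tree_positions [simp]:
  "inner i q \<in> tree_positions (Br Bs) \<longleftrightarrow> i < length Bs \<and> q \<in> tree_positions (Bs ! i)"
  by (simp add: tree_positions_def is_pos_inner_iff)

lemma is_pos_le_tdim: "is_pos n B p \<Longrightarrow> n \<le> tdim B"
proof (induction rule: is_pos.induct)
  case (inl n B q Bs)
  then show ?case by (auto simp: Max_ge_iff)
next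
  case (inr n Bs p B)
  then show ?case by (cases Bs) (auto intro: le_trans split: if_splits)
qed auto

lemma cells_Pos [simp]: "cells (Pos B) n = {p. is_pos n B p}"
  and src_Pos [simp]: "src (Pos B) n = psrc"
  and tgt_Pos [simp]: "tgt (Pos B) n = ptgt"
  by (simp_all add: Pos_def)

section \<open>The strict omega-category of subtrees\<close>

text \<open>
  A subtree of a tree consists of a segment of consecutive vertices and of a subtree of each of the
  children between them: \<open>Sub a xs\<close> starts at vertex \<open>a\<close>, and \<open>xs\<close> lists subtrees of the children
  \<open>a, a + 1, \<dots>\<close>. The ambient tree is not recorded; \<open>x\<close> is a subtree of \<open>B\<close> if and only if
  \<open>positions x \<subseteq> tree_positions B\<close>.
\<close>

datatype subtree = Sub nat "subtree list"

primrec positions :: "subtree \<Rightarrow> pos set" where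
  "positions (Sub a xs) =
     vertex ` {a..a + length xs} \<union> (\<Union>i<length xs. inner (a + i) ` (map positions xs ! i))"

declare positions.simps [simp del]

lemma vertex_in_positions [simp]:
  "vertex i \<in> positions (Sub a xs) \<longleftrightarrow> a \<le> i \<and> i \<le> a + length xs"
  by (auto simp: positions.simps)

lemma inner_in_positions [simp]:
  "inner i q \<in> positions (Sub a xs) \<longleftrightarrow> a \<le> i \<and> i < a + length xs \<and> q \<in> positions (xs ! (i - a))"
proof
  assume "a \<le> i \<and> i < a + length xs \<and> q \<in> positions (xs ! (i - a))"
  then show "inner i q \<in> positions (Sub a xs)"
    by (auto simp: positions.simps intro!: bexI[of _ "i - a"])
qed (auto simp: positions.simps)

text \<open>
  The vertices show where the segment starts and how long it is, and the remaining positions then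
  split according to the child that contains them. Hence subtrees that arise as supports of cells
  can be compared as sets.
\<close>

lemma positions_inject: "positions x = positions y \<longleftrightarrow> x = y"
proof
  show "positions x = positions y \<Longrightarrow> x = y"
  proof (induction x arbitrary: y)
    case (Sub a xs)
    obtain b ys where y: "y = Sub b ys" by (cases y)
    have mem: "p \<in> positions (Sub a xs) \<longleftrightarrow> p \<in> positions (Sub b ys)" for p
      using Sub.prems y by simp
    have "{a..a + length xs} = {b..b + length ys}"
      using mem[of "vertex _"] by (auto simp del: Icc_eq_Icc)
    then have ab: "a = b" "length xs = length ys" by auto
    have "xs ! i = ys ! i" if "i < length xs" for i
    proof (rule Sub.IH)
      show "xs ! i \<in> set xs" using that by simp
      show "positions (xs ! i) = positions (ys ! i)"
        using mem[of "inner (a + i) _"] that ab by auto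
    qed
    with ab y show ?case by (auto intro: nth_equalityI)
  qed
qed simp

primrec whole :: "tree \<Rightarrow> subtree" where
  "whole (Br Bs) = Sub 0 (map whole Bs)"

lemma positions_whole: "positions (whole B) = tree_positions B"
  by (induction B) (rule pos_set_eqI, auto)

text \<open>
  The boundary of dimension \<open>k\<close> shrinks each segment at height \<open>k\<close> to its first or its last vertex,
  which also discards everything above it.
\<close>

primrec boundary :: "bool \<Rightarrow> nat \<Rightarrow> subtree \<Rightarrow> subtree" where
  "boundary e 0 x = (case x of Sub a xs \<Rightarrow> Sub (if e then a else a + length xs) [])"
| "boundary e (Suc k) x = (case x of Sub a xs \<Rightarrow> Sub a (map (boundary e k) xs))"

text \<open>
  Composition in dimension \<open>m\<close> appends the segments at height \<open>m\<close>. The result is meaningful if the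
  target boundary of \<open>x\<close> in dimension \<open>m\<close> is the source boundary of \<open>y\<close>: then both agree below
  height \<open>m\<close>, and each segment of \<open>y\<close> at height \<open>m\<close> starts where that of \<open>x\<close> ends.
\<close>

primrec glue :: "nat \<Rightarrow> subtree \<Rightarrow> subtree \<Rightarrow> subtree" where
  "glue 0 x y = (case x of Sub a xs \<Rightarrow> case y of Sub b ys \<Rightarrow> Sub a (xs @ ys))"
| "glue (Suc m) x y = (case x of Sub a xs \<Rightarrow> case y of Sub b ys \<Rightarrow> Sub a (map2 (glue m) xs ys))"

lemma boundary_boundary: "m < k \<Longrightarrow> boundary e m (boundary e' k x) = boundary e m x"
proof (induction m arbitrary: k x)
  case 0
  then show ?case by (cases k; cases x) auto
next
  case (Suc m)
  then show ?case by (cases k; cases x) auto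
qed

text \<open>
  A segment of positive length at height \<open>k\<close> would contribute a position of dimension \<open>k + 1\<close>.
\<close>

lemma boundary_eq_self:
  "(\<And>p. p \<in> positions x \<Longrightarrow> pdim p \<le> k) \<Longrightarrow> boundary e k x = x"
proof (induction k arbitrary: x)
  case 0
  obtain a xs where x: "x = Sub a xs" by (cases x)
  have "xs = []"
  proof (cases xs)
    case (Cons y ys)
    obtain b zs where "y = Sub b zs" by (cases y)
    then have "inner a (vertex b) \<in> positions x" using x Cons by simp
    then show ?thesis using 0 by fastforce
  qed
  with x show ?case by simp
next
  case (Suc k)
  obtain a xs where x: "x = Sub a xs" by (cases x)
  have "boundary e k y = y" if y: "y \<in> set xs" for y
  proof (rule Suc.IH)
    fix q assume q: "q \<in> positions y"
    obtain i where "i < length xs" "y = xs ! i" using y by (auto simp: in_set_conv_nth)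
    then have "inner (a + i) q \<in> positions x" using x q by simp
    then show "pdim q \<le> k" using Suc.prems by fastforce
  qed
  then show ?case using x by (simp add: map_idI)
qed

lemma positions_boundary_subset: "positions (boundary e k x) \<subseteq> positions x"
proof (induction k arbitrary: x)
  case 0
  obtain a xs where x: "x = Sub a xs" by (cases x)
  show ?case
  proof
    fix p assume "p \<in> positions (boundary e 0 x)"
    then show "p \<in> positions x"
      using x by (cases p rule: pos_vertex_inner_cases) (auto split: if_splits)
  qed
next
  case (Suc k)
  obtain a xs where x: "x = Sub a xs" by (cases x)
  show ?case
  proof
    fix p assume "p \<in> positions (boundary e (Suc k) x)"
    then show "p \<in> positions x"
      using x subsetD[OF Suc.IH] by (cases p rule: pos_vertex_inner_cases) auto
  qed
qed

lemma positions_glue: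
  "boundary False m x = boundary True m y \<Longrightarrow> positions (glue m x y) = positions x \<union> positions y"
proof (induction m arbitrary: x y)
  case 0
  obtain a xs b ys where xy: "x = Sub a xs" "y = Sub b ys" by (cases x; cases y)
  with 0 have b: "b = a + length xs" by simp
  show ?case unfolding xy b by (rule pos_set_eqI) (auto simp: nth_append)
next
  case (Suc m)
  obtain a xs b ys where xy: "x = Sub a xs" "y = Sub b ys" by (cases x; cases y)
  with Suc.prems have e: "a = b" and m: "map (boundary False m) xs = map (boundary True m) ys"
    by auto
  have l: "length xs = length ys" using m map_eq_imp_length_eq by blast
  have "boundary False m (xs ! i) = boundary True m (ys ! i)" if "i < length xs" for i
    using m that l by (metis nth_map)
  then have "positions (glue m (xs ! i) (ys ! i)) = positions (xs ! i) \<union> positions (ys ! i)"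
    if "i < length xs" for i
    using Suc.IH that by blast
  then show ?case unfolding xy e using l by (intro pos_set_eqI) auto
qed

lemma boundary_glue_same:
  assumes "boundary False m x = boundary True m y"
  shows "boundary True m (glue m x y) = boundary True m x"
    and "boundary False m (glue m x y) = boundary False m y"
proof -
  have "boundary True m (glue m x y) = boundary True m x \<and>
    boundary False m (glue m x y) = boundary False m y"
    using assms
  proof (induction m arbitrary: x y)
    case 0
    then show ?case by (cases x; cases y) auto
  next
    case (Suc m)
    obtain a xs b ys where xy: "x = Sub a xs" "y = Sub b ys" by (cases x; cases y)
    with Suc.prems have e: "a = b" and m: "map (boundary False m) xs = map (boundary True m) ys"
      by auto
    have l: "length xs = length ys" using m map_eq_imp_length_eq by blast
    have "boundary False m (xs ! i) = boundary True m (ys ! i)" if "i < length xs" for i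
      using m that l by (metis nth_map)
    then show ?case using xy e l Suc.IH by (auto intro!: nth_equalityI)
  qed
  then show "boundary True m (glue m x y) = boundary True m x"
    and "boundary False m (glue m x y) = boundary False m y" by auto
qed

lemma boundary_glue_above:
  assumes "boundary False m x = boundary True m y" "m < k"
  shows "boundary e k (glue m x y) = glue m (boundary e k x) (boundary e k y)"
  using assms
proof (induction m arbitrary: x y k)
  case 0
  then show ?case by (cases x; cases y; cases k) auto
next
  case (Suc m)
  obtain a xs b ys where xy: "x = Sub a xs" "y = Sub b ys" by (cases x; cases y)
  obtain k' where k: "k = Suc k'" "m < k'" using Suc.prems by (cases k) auto
  with Suc.prems xy have e: "a = b" and m: "map (boundary False m) xs = map (boundary True m) ys"
    by auto
  have l: "length xs = length ys" using m map_eq_imp_length_eq by blast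
  have "boundary False m (xs ! i) = boundary True m (ys ! i)" if "i < length xs" for i
    using m that l by (metis nth_map)
  then show ?case using xy e l Suc.IH k by (auto intro!: nth_equalityI)
qed

text \<open>
  This is the form in which the fullness condition determines a support, since that condition
  prescribes generators in the top dimension only and leaves the rest to the boundary. The two
  boundaries fix all segments up to height \<open>m\<close>; above a segment of height \<open>m\<close> there is one vertex for
  each child, by the bound on dimensions, and the top-dimensional positions name it.
\<close>

lemma subtree_eqI:
  assumes "\<And>p. p \<in> positions x \<Longrightarrow> pdim p \<le> Suc m" "\<And>p. p \<in> positions y \<Longrightarrow> pdim p \<le> Suc m"
    and "\<And>e. boundary e m x = boundary e m y"
    and "\<And>p. pdim p = Suc m \<Longrightarrow> p \<in> positions x \<longleftrightarrow> p \<in> positions y"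
  shows "x = y"
  using assms
proof (induction m arbitrary: x y)
  case 0
  obtain a xs b ys where xy: "x = Sub a xs" "y = Sub b ys" by (cases x; cases y)
  have ab: "a = b" "length xs = length ys"
    using 0(3)[of True] 0(3)[of False] xy by auto
  have "xs ! i = ys ! i" if i: "i < length xs" for i
  proof -
    have dim0: "pdim q = 0" if "q \<in> positions (xs ! i) \<or> q \<in> positions (ys ! i)" for q
      using 0(1)[of "inner (a + i) q"] 0(2)[of "inner (a + i) q"] that i xy ab by auto
    have "q \<in> positions (xs ! i) \<longleftrightarrow> q \<in> positions (ys ! i)" if "pdim q = 0" for q
      using 0(4)[of "inner (a + i) q"] that i xy ab by auto
    then have "positions (xs ! i) = positions (ys ! i)" using dim0 by blast
    then show ?thesis by (simp add: positions_inject)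
  qed
  then show ?case using xy ab by (auto intro: nth_equalityI)
next
  case (Suc m)
  obtain a xs b ys where xy: "x = Sub a xs" "y = Sub b ys" by (cases x; cases y)
  have ab: "a = b" and bd: "map (boundary e m) xs = map (boundary e m) ys" for e
    using Suc.prems(3)[of e] xy by auto
  have l: "length xs = length ys" using bd map_eq_imp_length_eq by blast
  have "xs ! i = ys ! i" if i: "i < length xs" for i
  proof (rule Suc.IH)
    show "boundary e m (xs ! i) = boundary e m (ys ! i)" for e
      using bd[of e] i l by (metis nth_map)
    show "pdim q \<le> Suc m" if "q \<in> positions (xs ! i)" for q
      using Suc.prems(1)[of "inner (a + i) q"] that i xy by auto
    show "pdim q \<le> Suc m" if "q \<in> positions (ys ! i)" for q
      using Suc.prems(2)[of "inner (a + i) q"] that i xy ab l by auto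
    show "q \<in> positions (xs ! i) \<longleftrightarrow> q \<in> positions (ys ! i)" if "pdim q = Suc m" for q
      using Suc.prems(4)[of "inner (a + i) q"] that i xy ab l by auto
  qed
  then show ?case using xy ab l by (auto intro: nth_equalityI)
qed

text \<open>
  Every vertex except the first is the target of some arrow from its predecessor, and the first is
  the target of none; dually for sources. So the positions that are not faces of the opposite kind
  are those that the combinatorial boundary keeps in its top dimension.
\<close>

lemma boundary_positions:
  "{p. is_pos n B p \<and> (\<forall>q. is_pos (Suc n) B q \<longrightarrow> face (\<not> e) q \<noteq> p)} =
    {p \<in> positions (boundary e n (whole B)). pdim p = n}"
proof (induction n arbitrary: B)
  case 0
  obtain Bs where B: "B = Br Bs" by (cases B)
  let ?end = "if e then 0 else length Bs"
  have "vertex ?end \<noteq> face (\<not> e) q" if "is_pos 1 B q" for q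
    using that B by (cases q rule: pos_vertex_inner_cases) (auto simp: is_pos_iff)
  moreover have "\<exists>q. is_pos 1 B q \<and> face (\<not> e) q = vertex i" if "i \<noteq> ?end" "i \<le> length Bs" for i
  proof (intro exI conjI)
    let ?q = "inner (if e then i - 1 else i) (vertex 0)"
    show "is_pos 1 B ?q"
      using that B by (cases "Bs ! (if e then i - 1 else i)") (auto simp: is_pos_iff split: if_splits)
    show "face (\<not> e) ?q = vertex i" using that by (auto split: if_splits)
  qed
  ultimately have ends: "(\<forall>q. is_pos 1 B q \<longrightarrow> face (\<not> e) q \<noteq> vertex i) \<longleftrightarrow> i = ?end"
    if "i \<le> length Bs" for i
    using that by metis
  show ?case
  proof (rule pos_set_eqI)
    show "vertex i \<in> {p. is_pos 0 B p \<and> (\<forall>q. is_pos (Suc 0) B q \<longrightarrow> face (\<not> e) q \<noteq> p)} \<longleftrightarrow>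
      vertex i \<in> {p \<in> positions (boundary e 0 (whole B)). pdim p = 0}" for i
      using ends[of i] B by (cases "i \<le> length Bs") (auto simp: is_pos_vertex_iff)
  qed (use B in \<open>auto simp: is_pos_inner_iff\<close>)
next
  case (Suc n)
  obtain Bs where B: "B = Br Bs" by (cases B)
  let ?M = "\<lambda>n B. {p. is_pos n B p \<and> (\<forall>q. is_pos (Suc n) B q \<longrightarrow> face (\<not> e) q \<noteq> p)}"
  have "inner i q \<in> ?M (Suc n) B \<longleftrightarrow> i < length Bs \<and> q \<in> ?M n (Bs ! i)" for i q
  proof -
    have "(\<forall>r. is_pos (Suc (Suc n)) B r \<longrightarrow> face (\<not> e) r \<noteq> inner i q) \<longleftrightarrow>
      (\<forall>r. is_pos (Suc n) (Bs ! i) r \<longrightarrow> face (\<not> e) r \<noteq> q)" (is "?L \<longleftrightarrow> ?R") if "i < length Bs"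
    proof
      assume L: ?L
      show ?R
      proof (intro allI impI)
        fix r assume "is_pos (Suc n) (Bs ! i) r"
        then show "face (\<not> e) r \<noteq> q"
          using L[rule_format, of "inner i r"] that B by (auto simp: is_pos_iff)
      qed
    next
      assume R: ?R
      show ?L
      proof (intro allI impI)
        fix r assume "is_pos (Suc (Suc n)) B r"
        then show "face (\<not> e) r \<noteq> inner i q"
          using R B by (cases r rule: pos_vertex_inner_cases) (auto simp: is_pos_iff)
      qed
    qed
    then show ?thesis using B by (auto simp: is_pos_iff)
  qed
  moreover have "vertex i \<notin> ?M (Suc n) B" for i by (auto simp: is_pos_iff)
  ultimately show ?case unfolding Suc using B by (intro pos_set_eqI) (auto simp: Suc)
qed

lemma src_bdry_eq: "src_bdry n B = {p \<in> positions (boundary True n (whole B)). pdim p = n}"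
  using boundary_positions[of n B True] by (simp add: src_bdry_def face_def)

lemma tgt_bdry_eq: "tgt_bdry n B = {p \<in> positions (boundary False n (whole B)). pdim p = n}"
  using boundary_positions[of n B False] by (simp add: tgt_bdry_def face_def)

lemma pdim_positions_boundary: "p \<in> positions (boundary e k x) \<Longrightarrow> pdim p \<le> k"
proof (induction k arbitrary: x p)
  case 0
  then show ?case
    by (cases x; cases p rule: pos_vertex_inner_cases) auto
next
  case (Suc k)
  then show ?case
    by (cases x; cases p rule: pos_vertex_inner_cases) auto
qed

section \<open>Composites of pasting diagrams of subtrees\<close>

lemma tree_Cons_induct [case_names Nil Cons]:
  assumes "P (Br [])" "\<And>B Bs. P B \<Longrightarrow> P (Br Bs) \<Longrightarrow> P (Br (B # Bs))"
  shows "P B"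
proof (induction B)
  case (Br Bs)
  then show ?case by (induction Bs) (auto intro: assms)
qed

lemma positions_Cons:
  "positions (Sub 0 (x # xs)) = insert PInit (PInl ` positions x \<union> PInr ` positions (Sub 0 xs))"
proof (rule set_eqI)
  fix p
  have "PInr r \<in> positions (Sub 0 (x # xs)) \<longleftrightarrow> r \<in> positions (Sub 0 xs)" for r
  proof (cases r rule: pos_vertex_inner_cases)
    case (vertex i)
    then show ?thesis using vertex_in_positions[of "Suc i" 0 "x # xs"] by (simp add: vertex_simps)
  next
    case (inner i q)
    then show ?thesis using inner_in_positions[of "Suc i" q 0 "x # xs"] by (simp add: inner_simps)
  qed
  moreover have "PInl q \<in> positions (Sub 0 (x # xs)) \<longleftrightarrow> q \<in> positions x" for q
    using inner_in_positions[of 0 q 0 "x # xs"] by (simp add: inner_simps)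
  moreover have "PInit \<in> positions (Sub 0 (x # xs))"
    using vertex_in_positions[of 0 0 "x # xs"] by (simp add: vertex_simps)
  ultimately show "p \<in> positions (Sub 0 (x # xs)) \<longleftrightarrow>
      p \<in> insert PInit (PInl ` positions x \<union> PInr ` positions (Sub 0 xs))"
    by (cases p) auto
qed

lemma positions_Nil: "positions (Sub a []) = {vertex a}"
  by (rule pos_set_eqI) auto

lemma tree_positions_Nil: "tree_positions (Br []) = {PInit}"
  using positions_Nil[of 0] by (simp add: positions_whole[symmetric] vertex_simps)

lemma tree_positions_Cons:
  "tree_positions (Br (B # Bs)) =
    insert PInit (PInl ` tree_positions B \<union> PInr ` tree_positions (Br Bs))"
  using positions_Cons[of "whole B" "map whole Bs"] by (simp flip: positions_whole)

primrec end_vertex :: "bool \<Rightarrow> tree \<Rightarrow> pos" where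
  "end_vertex e (Br Bs) = vertex (if e then 0 else length Bs)"

lemma positions_boundary_0_whole: "positions (boundary e 0 (whole B)) = {end_vertex e B}"
  by (cases B) (simp add: positions_Nil)

lemma end_vertex_in_tree_positions [simp]: "end_vertex e B \<in> tree_positions B"
  by (cases B) simp

lemma pdim_end_vertex [simp]: "pdim (end_vertex e B) = 0"
  by (cases B) simp

lemma face_simps: "face e (PInr p) = PInr (face e p)"
  "face e (PInl q) = (if pdim q = 0 then (if e then PInit else PInr PInit) else PInl (face e q))"
  by (auto simp: face_def)

text \<open>
  A tree is assembled from its first child, raised by one dimension, and from the tree on the
  remaining children by gluing them at a vertex. The composite of the diagram \<open>F\<close> is built in the same
  way, with one gluing per child. The shift \<open>j\<close> is there for the induction: a child of \<open>B\<close> is a tree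
  of its own, but its vertices index subtrees of a dimension that is larger by one.
\<close>

lemma pasting:
  assumes "\<And>q p. q \<in> tree_positions B \<Longrightarrow> p \<in> positions (F q) \<Longrightarrow> pdim p \<le> pdim q + j"
    and "\<And>e q k. q \<in> tree_positions B \<Longrightarrow> pdim q = Suc k \<Longrightarrow> boundary e (k + j) (F q) = F (face e q)"
  shows "\<exists>x. positions x = (\<Union>q\<in>tree_positions B. positions (F q)) \<and>
    (\<forall>e k. positions (boundary e (k + j) x) =
      (\<Union>q\<in>positions (boundary e k (whole B)). positions (F q)))"
  using assms
proof (induction B arbitrary: F j rule: tree_Cons_induct)
  case Nil
  have "boundary e (k + j) (F PInit) = F PInit" for e k
    using Nil(1)[of PInit] by (intro boundary_eq_self) (auto simp: tree_positions_Nil intro: trans_le_add2)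
  moreover have "positions (boundary e k (whole (Br []))) = {PInit}" for e k
    by (cases k) (auto simp: positions_Nil vertex_simps)
  ultimately show ?case by (intro exI[of _ "F PInit"]) (auto simp: tree_positions_Nil)
next
  case (Cons B Bs)
  note dim = Cons.prems(1) and bd = Cons.prems(2)
  have "\<exists>x. positions x = (\<Union>q\<in>tree_positions B. positions (F (PInl q))) \<and>
    (\<forall>e k. positions (boundary e (k + Suc j) x) =
      (\<Union>q\<in>positions (boundary e k (whole B)). positions (F (PInl q))))"
  proof (rule Cons.IH(1))
    show "pdim p \<le> pdim q + Suc j" if "q \<in> tree_positions B" "p \<in> positions (F (PInl q))" for p q
      using dim[of "PInl q" p] that by (auto simp: tree_positions_Cons)
    show "boundary e (k + Suc j) (F (PInl q)) = F (PInl (face e q))"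
      if "q \<in> tree_positions B" "pdim q = Suc k" for e q k
      using bd[of "PInl q" "Suc k" e] that by (auto simp: tree_positions_Cons face_simps)
  qed
  then obtain x where x: "positions x = (\<Union>q\<in>tree_positions B. positions (F (PInl q)))"
    and bx: "\<And>e k. positions (boundary e (k + Suc j) x) =
      (\<Union>q\<in>positions (boundary e k (whole B)). positions (F (PInl q)))" by blast
  have "\<exists>y. positions y = (\<Union>q\<in>tree_positions (Br Bs). positions (F (PInr q))) \<and>
    (\<forall>e k. positions (boundary e (k + j) y) =
      (\<Union>q\<in>positions (boundary e k (whole (Br Bs))). positions (F (PInr q))))"
  proof (rule Cons.IH(2))
    show "pdim p \<le> pdim q + j"
      if "q \<in> tree_positions (Br Bs)" "p \<in> positions (F (PInr q))" for p q
      using dim[of "PInr q" p] that by (auto simp: tree_positions_Cons)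
    show "boundary e (k + j) (F (PInr q)) = F (PInr (face e q))"
      if "q \<in> tree_positions (Br Bs)" "pdim q = Suc k" for e q k
      using bd[of "PInr q" k e] that by (auto simp: tree_positions_Cons face_simps)
  qed
  then obtain y where y: "positions y = (\<Union>q\<in>tree_positions (Br Bs). positions (F (PInr q)))"
    and b_y: "\<And>e k. positions (boundary e (k + j) y) =
      (\<Union>q\<in>positions (boundary e k (whole (Br Bs))). positions (F (PInr q)))" by blast
  \<comment> \<open>The boundary in dimension \<open>Suc j\<close> is known from the first child; its own faces lie at the ends of that child.\<close>
  have bdx: "boundary e j x = F (if e then PInit else PInr PInit)" for e
  proof -
    have "boundary e (Suc j) x = F (PInl (end_vertex e B))"
      using bx[of e 0] by (simp only: positions_boundary_0_whole) (simp add: positions_inject)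
    then have "boundary e j x = boundary e j (F (PInl (end_vertex e B)))"
      using boundary_boundary[of j "Suc j" e e x] by simp
    also have "\<dots> = F (face e (PInl (end_vertex e B)))"
      using bd[of "PInl (end_vertex e B)" 0 e] by (simp add: tree_positions_Cons)
    finally show ?thesis by (simp add: face_simps)
  qed
  have bdy: "boundary e j y = F (PInr (end_vertex e (Br Bs)))" for e
    using b_y[of e 0] by (simp only: positions_boundary_0_whole) (simp add: positions_inject)
  have composable: "boundary False j x = boundary True j y"
    by (simp add: bdx bdy vertex_simps)
  let ?z = "glue j x y"
  \<comment> \<open>The first vertex belongs to neither part of the tree, but is a face of everything in the first child.\<close>
  have Init: "positions (F PInit) \<subseteq> positions (boundary e (k + Suc j) x)" for e k
    using bdx[of True] boundary_boundary[of j "k + Suc j" True e x]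
      positions_boundary_subset[of True j "boundary e (k + Suc j) x"] by simp
  have "positions (F PInit) \<subseteq> positions x"
    using Init positions_boundary_subset by blast
  then have "positions ?z = (\<Union>q\<in>tree_positions (Br (B # Bs)). positions (F q))"
    unfolding positions_glue[OF composable] tree_positions_Cons using x y by auto
  moreover have "positions (boundary e (k + j) ?z) =
      (\<Union>q\<in>positions (boundary e k (whole (Br (B # Bs)))). positions (F q))" for e k
  proof (cases k)
    case 0
    have "boundary e j ?z = F (end_vertex e (Br (B # Bs)))"
      using boundary_glue_same[OF composable] bdx[of True] bdy[of False]
      by (cases e) (auto simp: vertex_simps)
    then show ?thesis unfolding 0 by (simp only: positions_boundary_0_whole) simp
  next
    case (Suc k')
    have "boundary e (k + j) ?z = glue j (boundary e (k + j) x) (boundary e (k + j) y)"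
      by (rule boundary_glue_above[OF composable]) (simp add: Suc)
    moreover have "boundary False j (boundary e (k + j) x) = boundary True j (boundary e (k + j) y)"
    proof -
      have "j < k + j" by (simp add: Suc)
      then show ?thesis using composable by (simp only: boundary_boundary)
    qed
    ultimately have z: "positions (boundary e (k + j) ?z) =
        positions (boundary e (k' + Suc j) x) \<union> positions (boundary e (k + j) y)"
      using Suc by (simp add: positions_glue)
    have "positions (boundary e k (whole (Br (B # Bs)))) = insert PInit
        (PInl ` positions (boundary e k' (whole B)) \<union> PInr ` positions (boundary e k (whole (Br Bs))))"
      by (simp add: Suc positions_Cons)
    moreover have "(\<Union>q\<in>insert PInit (PInl ` P \<union> PInr ` Q). positions (F q)) =
        positions (F PInit) \<union> ((\<Union>q\<in>P. positions (F (PInl q))) \<union> (\<Union>q\<in>Q. positions (F (PInr q))))"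
      for P Q by auto
    ultimately have "(\<Union>q\<in>positions (boundary e k (whole (Br (B # Bs)))). positions (F q)) =
        positions (F PInit) \<union> positions (boundary e (k + j) ?z)"
      by (simp only: z bx[of e k'] b_y[of e k])
    moreover have "positions (F PInit) \<subseteq> positions (boundary e (k + j) ?z)"
      using Init[of e k'] z by blast
    ultimately show ?thesis by (simp only: Un_absorb1)
  qed
  ultimately show ?case by blast
qed

section \<open>Supports of cells\<close>

definition face_closed :: "pos set \<Rightarrow> bool" where
  "face_closed P \<longleftrightarrow> (\<forall>p\<in>P. \<forall>e. 0 < pdim p \<longrightarrow> face e p \<in> P)"

lemma face_closedD: "face_closed P \<Longrightarrow> p \<in> P \<Longrightarrow> 0 < pdim p \<Longrightarrow> face e p \<in> P"
  by (simp add: face_closed_def)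

lemma face_in_positions: "p \<in> positions x \<Longrightarrow> 0 < pdim p \<Longrightarrow> face e p \<in> positions x"
proof (induction p arbitrary: x rule: pos_vertex_inner_induct)
  case (inner i q)
  then show ?case by (cases x) auto
qed simp

lemma face_closed_positions: "face_closed (positions x)"
  by (simp add: face_closed_def face_in_positions)

lemma face_closed_tree_positions: "face_closed (tree_positions B)"
  using face_closed_positions[of "whole B"] by (simp add: positions_whole)

lemma pdim_face:
  assumes "pdim p = Suc n"
  shows "pdim (face e p) = n"
  using assms
proof (induction p arbitrary: n rule: pos_vertex_inner_induct)
  case (inner i q)
  then show ?case by (cases n) auto
qed simp

text \<open>
  The set of iterated faces of a position, as a subtree; its shape is the globe of dimension
  \<open>pdim p\<close>.
\<close>

primrec globe :: "pos \<Rightarrow> subtree" where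
  "globe PInit = Sub 0 []"
| "globe (PInl q) = Sub 0 [globe q]"
| "globe (PInr p) = (case globe p of Sub a xs \<Rightarrow> Sub (Suc a) xs)"

lemma globe_vertex [simp]: "globe (vertex i) = Sub i []"
  by (induction i) (auto simp: vertex_simps)

lemma globe_inner [simp]: "globe (inner i q) = Sub i [globe q]"
  by (induction i) (auto simp: inner_simps)

lemma boundary_globe: "pdim p = Suc k \<Longrightarrow> boundary e k (globe p) = globe (face e p)"
proof (induction p arbitrary: k rule: pos_vertex_inner_induct)
  case (inner i q)
  then show ?case by (cases k) auto
qed simp

lemma self_in_globe [simp]: "p \<in> positions (globe p)"
  by (induction p rule: pos_vertex_inner_induct) auto

lemma in_globe: "p \<in> positions (globe v) \<Longrightarrow> p = v \<or> pdim p < pdim v"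
proof (induction v arbitrary: p rule: pos_vertex_inner_induct)
  case (vertex i)
  then show ?case by (simp add: positions_Nil)
next
  case (inner i q)
  show ?case using inner.prems
    by (cases p rule: pos_vertex_inner_cases) (auto dest: inner.IH)
qed

text \<open>
  The two vertices of the globe of \<open>inner i q\<close> are reached as the faces of any position
  \<open>inner i (vertex a)\<close> in it, and the rest is the globe of \<open>q\<close>.
\<close>

lemma globe_subset:
  assumes "face_closed P" "v \<in> P"
  shows "positions (globe v) \<subseteq> P"
  using assms
proof (induction v arbitrary: P rule: pos_vertex_inner_induct)
  case (vertex i)
  then show ?case by (simp add: positions_Nil)
next
  case (inner i q)
  have sub: "positions (globe q) \<subseteq> {r. inner i r \<in> P}"
  proof (rule inner.IH)
    show "face_closed {r. inner i r \<in> P}"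
      unfolding face_closed_def
    proof (intro ballI allI impI)
      fix r e assume "r \<in> {r. inner i r \<in> P}" "0 < pdim r"
      then show "face e r \<in> {r. inner i r \<in> P}"
        using face_closedD[OF inner.prems(1), of "inner i r" e] by simp
    qed
  qed (use inner.prems in simp)
  obtain a xs where "globe q = Sub a xs" by (cases "globe q")
  then have "vertex a \<in> positions (globe q)" by simp
  then have "inner i (vertex a) \<in> P" using sub by blast
  then have "face e (inner i (vertex a)) \<in> P" for e
    using face_closedD[OF inner.prems(1), of "inner i (vertex a)" e] by simp
  from this[of True] this[of False] have ends: "vertex i \<in> P" "vertex (Suc i) \<in> P" by simp_all
  show ?case
  proof (intro subsetI)
    fix p assume "p \<in> positions (globe (inner i q))"
    then show "p \<in> P"
    proof (cases p rule: pos_vertex_inner_cases)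
      case (vertex j)
      then have "j = i \<or> j = Suc i" using \<open>p \<in> positions (globe (inner i q))\<close> by auto
      then show ?thesis using vertex ends by auto
    next
      case (inner j r)
      then have "j = i" "r \<in> positions (globe q)"
        using \<open>p \<in> positions (globe (inner i q))\<close> by auto
      then show ?thesis using inner sub by auto
    qed
  qed
qed

text \<open>
  The support of an \<open>n\<close>-cell records generators of dimension \<open>n\<close> only, and those of lower dimension
  cannot be recovered from the supports of its boundary: a composite of two arrows involves the
  vertex between them. Therefore the closed support collects generators of all dimensions.
\<close>

primrec closed_supp :: "cell \<Rightarrow> pos set" where
  "closed_supp (Var v) = positions (globe v)"
| "closed_supp (Coh B A \<tau>) = (\<Union>k. \<Union>p\<in>cells (Pos B) k. closed_supp (\<tau> k p))"

text \<open>
  Induction on the cells of a fixed computad: the values of \<open>\<tau>\<close> in \<open>Coh B A \<tau>\<close> are again cells of that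
  computad, while the cells in \<open>A\<close> live elsewhere and get no induction hypothesis.
\<close>

lemma cell_induct [consumes 1, case_names var coh]:
  assumes "is_cell C n c"
    and "\<And>n v. v \<in> gens C n \<Longrightarrow> P n (Var v)"
    and "\<And>n B A \<tau>. tdim B \<le> Suc n \<Longrightarrow> is_full n B A \<Longrightarrow> is_nhom (Suc n) (Free (Pos B)) C \<tau> \<Longrightarrow>
      (\<And>k p. is_pos k B p \<Longrightarrow> is_cell C k (\<tau> k p)) \<Longrightarrow>
      (\<And>k p. is_pos k B p \<Longrightarrow> P k (\<tau> k p)) \<Longrightarrow> P (Suc n) (Coh B A \<tau>)"
  shows "P n c"
proof -
  have "is_cell C' n c \<Longrightarrow> C' = C \<longrightarrow> P n c"
    and "is_nhom n D C' \<sigma> \<Longrightarrow> C' = C \<longrightarrow> (\<forall>k\<le>n. \<forall>v\<in>gens D k. P k (\<sigma> k v) \<and> is_cell C k (\<sigma> k v))"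
    and "is_full n' B A \<Longrightarrow> True" for C' n c D \<sigma> n' B A
  proof (induction rule: is_cell_is_nhom_is_full.inducts)
    case (coh B n A C' \<tau>)
    have "k \<le> Suc n" if "is_pos k B p" for k p
      using is_pos_le_tdim[OF that] coh by simp
    then show ?case using coh by (auto simp: Free_def intro!: assms(3))
  qed (auto intro: assms(2))
  with assms(1) show ?thesis by blast
qed

lemma closed_supp_dim:
  assumes "is_cell (Free (Pos B)) n c"
  shows "closed_supp c \<subseteq> {p \<in> tree_positions B. pdim p \<le> n}"
    and "supp n c = {p \<in> closed_supp c. pdim p = n}"
proof -
  have "closed_supp c \<subseteq> {p \<in> tree_positions B. pdim p \<le> n} \<and>
    supp n c = {p \<in> closed_supp c. pdim p = n}"
    using assms
  proof (induction rule: cell_induct)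
    case (var n v)
    then have v: "v \<in> tree_positions B" "pdim v = n" by (auto simp: Free_def is_pos_iff)
    then have "positions (globe v) \<subseteq> tree_positions B"
      by (intro globe_subset face_closed_tree_positions)
    then show ?case using v by (auto dest: in_globe)
  next
    case (coh n B1 A \<tau>)
    have le: "k \<le> Suc n" if "is_pos k B1 p" for k p
      using is_pos_le_tdim[OF that] coh by simp
    have IH1: "closed_supp (\<tau> k p) \<subseteq> {p \<in> tree_positions B. pdim p \<le> k}" if "is_pos k B1 p" for k p
      using coh.IH[OF that] by simp
    have IH2: "supp k (\<tau> k p) = {q \<in> closed_supp (\<tau> k p). pdim q = k}" if "is_pos k B1 p" for k p
      using coh.IH[OF that] by simp
    have "q \<in> supp (Suc n) (Coh B1 A \<tau>) \<longleftrightarrow> q \<in> closed_supp (Coh B1 A \<tau>) \<and> pdim q = Suc n" for q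
    proof
      assume "q \<in> supp (Suc n) (Coh B1 A \<tau>)"
      then show "q \<in> closed_supp (Coh B1 A \<tau>) \<and> pdim q = Suc n" using IH2 by auto
    next
      assume q: "q \<in> closed_supp (Coh B1 A \<tau>) \<and> pdim q = Suc n"
      then obtain k p where p: "is_pos k B1 p" "q \<in> closed_supp (\<tau> k p)" by auto
      then have "Suc n \<le> k" using IH1 q by fastforce
      then have "k = Suc n" using le[OF p(1)] by simp
      then show "q \<in> supp (Suc n) (Coh B1 A \<tau>)" using p q IH2 by auto
    qed
    moreover have "closed_supp (Coh B1 A \<tau>) \<subseteq> {p \<in> tree_positions B. pdim p \<le> Suc n}"
      using IH1 le by fastforce
    ultimately show ?case by blast
  qed
  then show "closed_supp c \<subseteq> {p \<in> tree_positions B. pdim p \<le> n}"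
    and "supp n c = {p \<in> closed_supp c. pdim p = n}" by auto
qed

lemma height_ps [simp]: "height (ps X n p q) = Suc n"
  by (induction n arbitrary: p q) auto

lemma sphere_act_ps: "\<exists>S. sphere_act \<sigma> (ps X n p q) = Sph S (\<sigma> n p) (\<sigma> n q)"
  by (cases n) auto

lemma gens_Free [simp]: "gens (Free X) n = cells X n"
  and attach_Free_Suc [simp]: "attach (Free X) (Suc n) x = ps X n (src X n x) (tgt X n x)"
  by (simp_all add: Free_def)

text \<open>
  By induction this comes down to a generator \<open>v\<close>, where the faces of \<open>v\<close> also occur on the right
  hand side. They add nothing, because \<open>F\<close> sends a face to a boundary, which is a subset.
\<close>

lemma closed_supp_act:
  assumes "is_cell (Free (Pos B)) n a"
    and F: "\<And>q. q \<in> tree_positions B \<Longrightarrow> positions (F q) = closed_supp (\<tau> (pdim q) q)"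
    and face: "\<And>q k e. q \<in> tree_positions B \<Longrightarrow> pdim q = Suc k \<Longrightarrow> boundary e k (F q) = F (face e q)"
  shows "closed_supp (act \<tau> n a) = (\<Union>q\<in>closed_supp a. positions (F q))"
  using assms(1)
proof (induction rule: cell_induct)
  case (var n v)
  then have v: "v \<in> tree_positions B" "pdim v = n" by (auto simp: is_pos_iff)
  let ?P = "{q \<in> tree_positions B. positions (F q) \<subseteq> positions (F v)}"
  have "face_closed ?P"
    unfolding face_closed_def
  proof (intro ballI allI impI)
    fix q e assume q: "q \<in> ?P" "0 < pdim q"
    then obtain k where "pdim q = Suc k" by (cases "pdim q") auto
    then have "F (face e q) = boundary e k (F q)" using face q by simp
    then show "face e q \<in> ?P"
      using q positions_boundary_subset[of e k "F q"] face_closedD[OF face_closed_tree_positions] by auto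
  qed
  then have "positions (globe v) \<subseteq> ?P" using v by (intro globe_subset) auto
  moreover have "v \<in> positions (globe v)" by simp
  ultimately have "(\<Union>q\<in>positions (globe v). positions (F q)) = positions (F v)" by blast
  then show ?case using F[of v] v by simp
next
  case (coh n B1 A \<tau>1)
  have le: "k \<le> Suc n" if "is_pos k B1 p" for k p
    using is_pos_le_tdim[OF that] coh by simp
  have "closed_supp (act \<tau> (Suc n) (Coh B1 A \<tau>1)) =
      (\<Union>k. \<Union>p\<in>cells (Pos B1) k. closed_supp (act \<tau> k (\<tau>1 k p)))"
    using le by auto
  then show ?case using coh.IH by auto
qed

text \<open>
  The three parts need each other: the boundary of a coherence cell involves a full sphere of cells
  over another tree \<open>B\<close>, and the fact that these cells are supported on the boundaries of \<open>B\<close> rests on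
  the first part, applied to them. In the first part, knowledge of the boundaries of \<open>x\<close> is what
  turns the values of a homomorphism into a diagram as needed for the pasting lemma.
\<close>

lemma cell_subtree:
  shows "is_cell C n c \<Longrightarrow> \<forall>B. C = Free (Pos B) \<longrightarrow> (\<exists>x. positions x = closed_supp c \<and>
      (\<forall>m S a b e. n = Suc m \<longrightarrow> bdry C n c = Sph S a b \<longrightarrow>
        positions (boundary e m x) = closed_supp (if e then a else b)))"
    and "is_nhom n D C \<sigma> \<Longrightarrow>
      \<forall>B B'. D = Free (Pos B) \<longrightarrow> C = Free (Pos B') \<longrightarrow> tdim B \<le> n \<longrightarrow>
        (\<exists>F. \<forall>q\<in>tree_positions B. positions (F q) = closed_supp (\<sigma> (pdim q) q) \<and>
          (\<forall>k e. pdim q = Suc k \<longrightarrow> boundary e k (F q) = F (face e q)))"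
    and "is_full n B A \<Longrightarrow> height A = Suc n \<and> (\<exists>S a b. A = Sph S a b \<and>
      is_cell (Free (Pos B)) n a \<and> is_cell (Free (Pos B)) n b \<and>
      closed_supp a = positions (boundary True n (whole B)) \<and>
      closed_supp b = positions (boundary False n (whole B)))"
proof (induction rule: is_cell_is_nhom_is_full.inducts)
  case (var v C n)
  show ?case
  proof (intro allI impI)
    fix B assume C: "C = Free (Pos B)"
    then have v: "pdim v = n" using var by (simp add: is_pos_iff)
    have "positions (boundary e m (globe v)) = closed_supp (if e then a else b)"
      if "n = Suc m" "bdry C n (Var v) = Sph S a b" for m S a b e
    proof -
      have "a = Var (psrc v)" "b = Var (ptgt v)" using that C by (cases m; simp)+
      then show ?thesis using boundary_globe[of v m e] that v by (auto simp: face_def)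
    qed
    then show "\<exists>x. positions x = closed_supp (Var v) \<and>
      (\<forall>m S a b e. n = Suc m \<longrightarrow> bdry C n (Var v) = Sph S a b \<longrightarrow>
        positions (boundary e m x) = closed_supp (if e then a else b))"
      by (intro exI[of _ "globe v"]) simp
  qed
next
  case (coh B n A C \<tau>)
  show ?case
  proof (intro allI impI)
    fix B' assume C: "C = Free (Pos B')"
    obtain F where F: "\<And>q. q \<in> tree_positions B \<Longrightarrow> positions (F q) = closed_supp (\<tau> (pdim q) q)"
      and face: "\<And>q k e. q \<in> tree_positions B \<Longrightarrow> pdim q = Suc k \<Longrightarrow> boundary e k (F q) = F (face e q)"
      using coh C by blast
    have cell: "is_cell C (pdim q) (\<tau> (pdim q) q)" if q: "q \<in> tree_positions B" for q
    proof -
      have "is_pos (pdim q) B q" using q by (simp add: is_pos_iff)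
      moreover from is_pos_le_tdim[OF this] have "pdim q \<le> Suc n" using coh.hyps by simp
      ultimately show ?thesis using coh.hyps(3) by (auto elim!: is_nhom.cases)
    qed
    have "\<exists>x. positions x = (\<Union>q\<in>tree_positions B. positions (F q)) \<and>
      (\<forall>e k. positions (boundary e (k + 0) x) =
        (\<Union>q\<in>positions (boundary e k (whole B)). positions (F q)))"
    proof (rule pasting)
      show "pdim p \<le> pdim q + 0" if "q \<in> tree_positions B" "p \<in> positions (F q)" for p q
        using closed_supp_dim(1) cell F C that by fastforce
    qed (use face in simp)
    then obtain x where x: "positions x = (\<Union>q\<in>tree_positions B. positions (F q))"
      and bx: "\<And>e k. positions (boundary e k x) =
        (\<Union>q\<in>positions (boundary e k (whole B)). positions (F q))" by auto
    have "positions x = closed_supp (Coh B A \<tau>)"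
      using x F by (auto simp: is_pos_iff)
    moreover have "positions (boundary e m x) = closed_supp (if e then a' else b')"
      if m: "Suc n = Suc m" "bdry C (Suc n) (Coh B A \<tau>) = Sph S' a' b'" for m S' a' b' e
    proof -
      obtain S a b where A: "A = Sph S a b" "height S = n"
        and ab: "is_cell (Free (Pos B)) n a" "is_cell (Free (Pos B)) n b"
        "closed_supp a = positions (boundary True n (whole B))"
        "closed_supp b = positions (boundary False n (whole B))"
        using coh.IH by auto
      have "a' = act \<tau> n a" "b' = act \<tau> n b" using m A by auto
      then show ?thesis
        using closed_supp_act[OF ab(1), of F \<tau>] closed_supp_act[OF ab(2), of F \<tau>]
          F face ab bx m by simp
    qed
    ultimately show "\<exists>x. positions x = closed_supp (Coh B A \<tau>) \<and>
      (\<forall>m S a b e. Suc n = Suc m \<longrightarrow> bdry C (Suc n) (Coh B A \<tau>) = Sph S a b \<longrightarrow>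
        positions (boundary e m x) = closed_supp (if e then a else b))"
      by blast
  qed
next
  case (nhom n D C \<sigma>)
  show ?case
  proof (intro allI impI)
    fix B B' assume D: "D = Free (Pos B)" and C: "C = Free (Pos B')" and le: "tdim B \<le> n"
    have le: "k \<le> n" if "is_pos k B q" for k q using is_pos_le_tdim[OF that] le by simp
    define R where "R q x \<longleftrightarrow> positions x = closed_supp (\<sigma> (pdim q) q) \<and>
      (\<forall>m S a b e. pdim q = Suc m \<longrightarrow> bdry C (pdim q) (\<sigma> (pdim q) q) = Sph S a b \<longrightarrow>
        positions (boundary e m x) = closed_supp (if e then a else b))" for q x
    have "\<exists>x. R q x" if "q \<in> tree_positions B" for q
      unfolding R_def using nhom.IH(1)[of "pdim q" q] le[of "pdim q" q] that C D by (auto simp: is_pos_iff)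
    then obtain F where F: "\<And>q. q \<in> tree_positions B \<Longrightarrow> R q (F q)" by metis
    have "boundary e k (F q) = F (face e q)" if q: "q \<in> tree_positions B" "pdim q = Suc k" for q k e
    proof -
      have "bdry C (Suc k) (\<sigma> (Suc k) q) = sphere_act \<sigma> (ps (Pos B) k (psrc q) (ptgt q))"
        using nhom.hyps q D le[of "Suc k" q] by (auto simp: is_pos_iff)
      then obtain S where "bdry C (Suc k) (\<sigma> (Suc k) q) = Sph S (\<sigma> k (psrc q)) (\<sigma> k (ptgt q))"
        using sphere_act_ps by metis
      then have "positions (boundary e k (F q)) = closed_supp (if e then \<sigma> k (psrc q) else \<sigma> k (ptgt q))"
        using F[OF q(1)] q by (simp add: R_def)
      also have "\<dots> = closed_supp (\<sigma> k (face e q))" by (simp add: face_def)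
      also have "\<dots> = positions (F (face e q))"
        using F[of "face e q"] face_closedD[OF face_closed_tree_positions q(1)] q pdim_face[OF q(2)]
        by (simp add: R_def)
      finally show ?thesis by (simp add: positions_inject)
    qed
    with F show "\<exists>F. \<forall>q\<in>tree_positions B. positions (F q) = closed_supp (\<sigma> (pdim q) q) \<and>
          (\<forall>k e. pdim q = Suc k \<longrightarrow> boundary e k (F q) = F (face e q))"
      by (intro exI[of _ F]) (auto simp: R_def)
  qed
next
  case (full_0 p B q)
  have "positions (globe r) = {r}" if "pdim r = 0" for r
    using that by (auto simp: pdim_0_iff positions_Nil)
  with full_0 show ?case
    by (auto simp: src_bdry_eq tgt_bdry_eq positions_boundary_0_whole is_pos_iff
        simp del: boundary.simps intro!: is_cell_is_nhom_is_full.var)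
next
  case (full_Suc n B A a b)
  obtain S a' b' where A: "A = Sph S a' b'" "height A = Suc n"
    and cs: "closed_supp a' = positions (boundary True n (whole B))"
      "closed_supp b' = positions (boundary False n (whole B))"
    using full_Suc.IH(1) by (elim conjE exE)
  have main: "closed_supp c = positions (boundary e (Suc n) (whole B))"
    if c: "is_cell (Free (Pos B)) (Suc n) c" "bdry (Free (Pos B)) (Suc n) c = A"
      "supp (Suc n) c = {p \<in> positions (boundary e (Suc n) (whole B)). pdim p = Suc n}"
      and IH: "\<forall>B'. Free (Pos B) = Free (Pos B') \<longrightarrow> (\<exists>x. positions x = closed_supp c \<and>
      (\<forall>m S a b e. Suc n = Suc m \<longrightarrow> bdry (Free (Pos B)) (Suc n) c = Sph S a b \<longrightarrow>
        positions (boundary e m x) = closed_supp (if e then a else b)))" for c e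
  proof -
    obtain x where x: "positions x = closed_supp c"
      and bx: "\<And>e. positions (boundary e n x) = closed_supp (if e then a' else b')"
      using IH[rule_format, OF refl] c(2) A(1) by auto
    \<comment> \<open>Below the top dimension both sides agree by fullness of \<open>A\<close>, in the top dimension by fullness of the new sphere.\<close>
    have "x = boundary e (Suc n) (whole B)"
    proof (rule subtree_eqI)
      show "pdim p \<le> Suc n" if "p \<in> positions x" for p
        using closed_supp_dim(1)[OF c(1)] that x by auto
      show "pdim p \<le> Suc n" if "p \<in> positions (boundary e (Suc n) (whole B))" for p
        using pdim_positions_boundary that by blast
      have "positions (boundary e' n x) = positions (boundary e' n (whole B))" for e'
        using bx[of e'] cs by (cases e') auto
      then show "boundary e' n x = boundary e' n (boundary e (Suc n) (whole B))" for e'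
        by (simp only: positions_inject boundary_boundary lessI)
      show "p \<in> positions x \<longleftrightarrow> p \<in> positions (boundary e (Suc n) (whole B))"
        if "pdim p = Suc n" for p
        using closed_supp_dim(2)[OF c(1)] c(3) x that by blast
    qed
    with x show ?thesis by simp
  qed
  have "closed_supp a = positions (boundary True (Suc n) (whole B))"
    using full_Suc.hyps(2,3,6) full_Suc.IH(2) unfolding src_bdry_eq by (rule main)
  moreover have "closed_supp b = positions (boundary False (Suc n) (whole B))"
    using full_Suc.hyps(4,5,7) full_Suc.IH(3) unfolding tgt_bdry_eq by (rule main)
  ultimately show ?case using A(2) full_Suc.hyps(2,4) by (simp del: boundary.simps)
qed

section \<open>Immersions and subtrees\<close>

text \<open>
  Forgetting where a subtree lies leaves a tree, which \<open>embed_pos\<close> maps onto the subtree.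
\<close>

primrec shape :: "subtree \<Rightarrow> tree" where
  "shape (Sub a xs) = Br (map shape xs)"

primrec embed_pos :: "pos \<Rightarrow> subtree \<Rightarrow> pos" where
  "embed_pos PInit x = (case x of Sub a xs \<Rightarrow> vertex a)"
| "embed_pos (PInl q) x = (case x of Sub a xs \<Rightarrow> inner a (embed_pos q (hd xs)))"
| "embed_pos (PInr p) x = (case x of Sub a xs \<Rightarrow> embed_pos p (Sub (Suc a) (tl xs)))"

lemma embed_vertex [simp]: "embed_pos (vertex i) (Sub a xs) = vertex (a + i)"
proof (induction i arbitrary: a xs)
  case 0
  then show ?case by (simp add: vertex_simps(1))
next
  case (Suc i)
  have "embed_pos (vertex (Suc i)) (Sub a xs) = embed_pos (vertex i) (Sub (Suc a) (tl xs))"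
    by (simp add: vertex_simps)
  then show ?case using Suc by simp
qed

lemma embed_inner [simp]:
  "i < length xs \<Longrightarrow> embed_pos (inner i q) (Sub a xs) = inner (a + i) (embed_pos q (xs ! i))"
proof (induction i arbitrary: a xs)
  case 0
  then show ?case by (simp add: inner_simps(1)[of q] hd_conv_nth)
next
  case (Suc i)
  have "embed_pos (inner (Suc i) q) (Sub a xs) = embed_pos (inner i q) (Sub (Suc a) (tl xs))"
    by (simp add: inner_simps)
  also have "\<dots> = inner (Suc a + i) (embed_pos q (tl xs ! i))" using Suc by simp
  finally show ?case using Suc.prems by (simp add: nth_tl)
qed

lemma pdim_embed [simp]: "p \<in> tree_positions (shape x) \<Longrightarrow> pdim (embed_pos p x) = pdim p"
proof (induction p arbitrary: x rule: pos_vertex_inner_induct)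
  case (vertex i)
  then show ?case by (cases x) auto
next
  case (inner i q)
  then show ?case by (cases x) auto
qed

lemma face_embed:
  "p \<in> tree_positions (shape x) \<Longrightarrow> 0 < pdim p \<Longrightarrow> embed_pos (face e p) x = face e (embed_pos p x)"
proof (induction p arbitrary: x rule: pos_vertex_inner_induct)
  case (inner i q)
  then show ?case by (cases x) auto
qed simp

lemma inj_on_embed: "inj_on (\<lambda>p. embed_pos p x) (tree_positions (shape x))"
proof (rule inj_onI)
  fix p q assume "p \<in> tree_positions (shape x)" "q \<in> tree_positions (shape x)" "embed_pos p x = embed_pos q x"
  then show "p = q"
  proof (induction p arbitrary: q x rule: pos_vertex_inner_induct)
    case (vertex i)
    then show ?case by (cases x; cases q rule: pos_vertex_inner_cases) auto
  next
    case (inner i r)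
    then show ?case by (cases x; cases q rule: pos_vertex_inner_cases) auto
  qed
qed

lemma embed_in_positions: "p \<in> tree_positions (shape x) \<Longrightarrow> embed_pos p x \<in> positions x"
proof (induction p arbitrary: x rule: pos_vertex_inner_induct)
  case (vertex i)
  then show ?case by (cases x) auto
next
  case (inner i q)
  then show ?case by (cases x) auto
qed

lemma image_embed: "(\<lambda>p. embed_pos p x) ` tree_positions (shape x) = positions x"
proof (intro subset_antisym subsetI)
  fix p assume "p \<in> positions x"
  then show "p \<in> (\<lambda>p. embed_pos p x) ` tree_positions (shape x)"
  proof (induction p arbitrary: x rule: pos_vertex_inner_induct)
    case (vertex i)
    obtain a xs where x: "x = Sub a xs" by (cases x)
    then show ?case using vertex by (intro image_eqI[of _ _ "vertex (i - a)"]) auto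
  next
    case (inner i q)
    obtain a xs where x: "x = Sub a xs" by (cases x)
    then obtain r where "r \<in> tree_positions (shape (xs ! (i - a)))" "q = embed_pos r (xs ! (i - a))"
      using inner by auto
    then show ?case using inner.prems x by (intro image_eqI[of _ _ "inner (i - a) r"]) auto
  qed
qed (auto simp: embed_in_positions)

lemma shape_whole [simp]: "shape (whole B) = B"
  by (induction B) (auto intro: map_idI)

lemma embed_whole: "p \<in> tree_positions B \<Longrightarrow> embed_pos p (whole B) = p"
proof (induction p arbitrary: B rule: pos_vertex_inner_induct)
  case (vertex i)
  then show ?case by (cases B) auto
next
  case (inner i q)
  then show ?case by (cases B) auto
qed

text \<open>
  Consecutive vertices are joined by a position of dimension \<open>1\<close>, so a map that preserves faces and
  dimensions is determined on vertices by the image of the first one: it is a translation. All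
  positions over a given child share their end vertices and so are sent into a single child,
  and the argument repeats there.
\<close>

lemma globular_map_eq_embed:
  assumes "\<And>p. p \<in> tree_positions D \<Longrightarrow> pdim (h p) = pdim p"
    and "\<And>p e. p \<in> tree_positions D \<Longrightarrow> 0 < pdim p \<Longrightarrow> h (face e p) = face e (h p)"
  shows "\<exists>x. shape x = D \<and> (\<forall>p\<in>tree_positions D. h p = embed_pos p x)"
  using assms
proof (induction D arbitrary: h)
  case (Br Ds)
  note dim = Br.prems(1) and face = Br.prems(2)
  obtain a where a: "h (vertex 0) = vertex a"
    using dim[of "vertex 0"] by (auto simp: pdim_0_iff)
  have v0: "vertex 0 \<in> tree_positions B" for B by (cases B) simp
  have vertex: "h (vertex i) = vertex (a + i)" if "i \<le> length Ds" for i
    using that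
  proof (induction i)
    case (Suc i)
    let ?p = "inner i (vertex 0)"
    have p: "?p \<in> tree_positions (Br Ds)" using Suc v0 by simp
    obtain k r where k: "h ?p = inner k r" "pdim r = 0"
      using dim[OF p] by (auto simp: pdim_Suc_iff)
    have "vertex (a + i) = vertex k" "h (vertex (Suc i)) = vertex (Suc k)"
      using face[OF p, of True] face[OF p, of False] k Suc by auto
    then show ?case by simp
  qed (use a in simp)
  have "\<exists>r. h (inner i q) = inner (a + i) r \<and> pdim r = pdim q"
    if "i < length Ds" "q \<in> tree_positions (Ds ! i)" for i q
    using that(2)
  proof (induction "pdim q" arbitrary: q)
    case 0
    have p: "inner i q \<in> tree_positions (Br Ds)" using 0 that by simp
    obtain k r where k: "h (inner i q) = inner k r" "pdim r = 0"
      using dim[OF p] 0 by (auto simp: pdim_Suc_iff)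
    have "vertex (a + i) = vertex k" using face[OF p, of True] k 0 vertex[of i] that by auto
    then show ?case using k 0 by auto
  next
    case (Suc n)
    have p: "inner i q \<in> tree_positions (Br Ds)" using Suc that by simp
    obtain k r where k: "h (inner i q) = inner k r" "pdim r = Suc n"
      using dim[OF p] Suc(2) by (auto simp: pdim_Suc_iff)
    have "pdim (face True q) = n" using pdim_face Suc(2) by metis
    moreover have "face True q \<in> tree_positions (Ds ! i)"
      using face_closedD[OF face_closed_tree_positions Suc(3)] Suc(2) by simp
    ultimately obtain s where "h (inner i (face True q)) = inner (a + i) s" using Suc(1) by blast
    moreover have "h (inner i (face True q)) = inner k (face True r)"
      using face[OF p, of True] k Suc(2) by auto
    ultimately show ?case using k Suc(2) by auto
  qed
  then obtain h' where h': "\<And>i q. i < length Ds \<Longrightarrow> q \<in> tree_positions (Ds ! i) \<Longrightarrow>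
      h (inner i q) = inner (a + i) (h' i q) \<and> pdim (h' i q) = pdim q" by metis
  have "\<exists>x. shape x = Ds ! i \<and> (\<forall>p\<in>tree_positions (Ds ! i). h' i p = embed_pos p x)"
    if i: "i < length Ds" for i
  proof (rule Br.IH)
    show "Ds ! i \<in> set Ds" using i by simp
    show "pdim (h' i q) = pdim q" if "q \<in> tree_positions (Ds ! i)" for q
      using h' i that by blast
    show "h' i (face e q) = face e (h' i q)" if q: "q \<in> tree_positions (Ds ! i)" "0 < pdim q" for q e
    proof -
      have "inner (a + i) (h' i (face e q)) = h (face e (inner i q))"
        using h'[OF i] face_closedD[OF face_closed_tree_positions q] q by simp
      also have "\<dots> = face e (inner (a + i) (h' i q))"
        using face[of "inner i q" e] h'[OF i q(1)] i q by simp
      also have "\<dots> = inner (a + i) (face e (h' i q))" using h'[OF i q(1)] q by simp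
      finally show ?thesis by simp
    qed
  qed
  then obtain x where x: "\<And>i. i < length Ds \<Longrightarrow> shape (x i) = Ds ! i"
    "\<And>i p. i < length Ds \<Longrightarrow> p \<in> tree_positions (Ds ! i) \<Longrightarrow> h' i p = embed_pos p (x i)" by metis
  let ?x = "Sub a (map x [0..<length Ds])"
  have "shape ?x = Br Ds" using x(1) by (auto intro: nth_equalityI)
  moreover have "h p = embed_pos p ?x" if "p \<in> tree_positions (Br Ds)" for p
    using that vertex h' x(2) by (cases p rule: pos_vertex_inner_cases) auto
  ultimately show ?case by blast
qed

definition subtree_map :: "subtree \<Rightarrow> nat \<Rightarrow> pos \<Rightarrow> pos" where
  "subtree_map x = (\<lambda>n. \<lambda>p\<in>cells (Pos (shape x)) n. embed_pos p x)"

lemma subtree_map_in_Theta0: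
  assumes "positions x \<subseteq> tree_positions B"
  shows "subtree_map x \<in> Theta0 (shape x) B"
proof -
  have "subtree_map x n \<in> cells (Pos (shape x)) n \<rightarrow>\<^sub>E cells (Pos B) n" for n
    using assms embed_in_positions[of _ x] by (auto simp: subtree_map_def is_pos_iff)
  moreover have "embed_pos (psrc p) x = psrc (embed_pos p x) \<and> embed_pos (ptgt p) x = ptgt (embed_pos p x) \<and>
      is_pos n (shape x) (psrc p) \<and> is_pos n (shape x) (ptgt p)"
    if "is_pos (Suc n) (shape x) p" for n p
    using face_embed[of p x True] face_embed[of p x False] that pos_src[OF that refl]
    by (simp add: face_def is_pos_iff)
  ultimately show ?thesis by (simp add: Theta0_def glob_hom_def subtree_map_def)
qed

lemma Theta0_subtree_map:
  assumes g: "g \<in> Theta0 D B"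
  obtains x where "shape x = D" "positions x \<subseteq> tree_positions B" "g = subtree_map x"
proof -
  let ?h = "\<lambda>p. g (pdim p) p"
  have pos: "is_pos (pdim p) B (?h p)" if "p \<in> tree_positions D" for p
    using g that by (auto simp: Theta0_def glob_hom_def is_pos_iff[of _ D] PiE_def Pi_def)
  have "\<exists>x. shape x = D \<and> (\<forall>p\<in>tree_positions D. ?h p = embed_pos p x)"
  proof (rule globular_map_eq_embed)
    show "pdim (?h p) = pdim p" if "p \<in> tree_positions D" for p
      using pos[OF that] is_pos_pdim by blast
    show "?h (face e p) = face e (?h p)" if p: "p \<in> tree_positions D" "0 < pdim p" for p e
    proof -
      obtain n where n: "pdim p = Suc n" using p(2) by (cases "pdim p") auto
      then have "is_pos (Suc n) D p" using p(1) by (simp add: is_pos_iff)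
      then have "g n (psrc p) = psrc (g (Suc n) p)" "g n (ptgt p) = ptgt (g (Suc n) p)"
        using g by (auto simp: Theta0_def glob_hom_def)
      then show ?thesis using n pdim_face[OF n, of e] by (cases e) (auto simp: face_def)
    qed
  qed
  then obtain x where x: "shape x = D" "\<And>p. p \<in> tree_positions D \<Longrightarrow> ?h p = embed_pos p x" by blast
  have "positions x \<subseteq> tree_positions B"
    unfolding image_embed[symmetric] using x pos by (auto simp: is_pos_iff[of _ B])
  moreover have "g n p = subtree_map x n p" for n p
    using g x by (cases "is_pos n D p")
      (auto simp: Theta0_def glob_hom_def subtree_map_def is_pos_iff PiE_def extensional_def)
  ultimately show thesis using that x(1) by blast
qed

section \<open>Functoriality of the action on cells\<close>

definition rename :: "(pos \<Rightarrow> pos) \<Rightarrow> chom" where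
  "rename h = (\<lambda>n v. Var (h v))"

lemma act_cong:
  assumes "is_cell C n c" "\<And>k v. v \<in> gens C k \<Longrightarrow> \<sigma> k v = \<sigma>' k v"
  shows "act \<sigma> n c = act \<sigma>' n c"
  using assms(1)
proof (induction rule: cell_induct)
  case (coh n B A \<tau>)
  then show ?case by (auto simp: fun_eq_iff)
qed (simp add: assms(2))

text \<open>
  The bound \<open>N\<close> is needed because the homomorphism inside a coherence cell is undefined above the
  dimension of that cell.
\<close>

lemma act_compose:
  assumes "is_cell C n c" "n \<le> N"
    and "\<And>k v. k \<le> N \<Longrightarrow> v \<in> gens C k \<Longrightarrow> \<rho> k v = act \<sigma> k (\<tau> k v)"
  shows "act \<rho> n c = act \<sigma> n (act \<tau> n c)"
  using assms(1,2)
proof (induction rule: cell_induct)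
  case (coh n B A t)
  then show ?case by (auto simp: fun_eq_iff)
qed (simp add: assms(3))

lemma height_sphere_act [simp]: "height (sphere_act \<sigma> A) = height A"
  by (induction A) auto

lemma sphere_act_compose_full:
  assumes "is_full n B A" "n \<le> N"
    and \<rho>: "\<And>k v. k \<le> N \<Longrightarrow> is_pos k B v \<Longrightarrow> \<rho> k v = act \<sigma> k (\<tau> k v)"
  shows "sphere_act \<rho> A = sphere_act \<sigma> (sphere_act \<tau> A)"
proof -
  have "is_cell C m c \<Longrightarrow> True" and "is_nhom m D C \<sigma> \<Longrightarrow> True"
    and "is_full n B A \<Longrightarrow> n \<le> N \<longrightarrow> (\<forall>k v. k \<le> N \<longrightarrow> is_pos k B v \<longrightarrow> \<rho> k v = act \<sigma> k (\<tau> k v)) \<longrightarrow>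
      sphere_act \<rho> A = sphere_act \<sigma> (sphere_act \<tau> A) \<and> height A = Suc n"
    for C m c D
  proof (induction rule: is_cell_is_nhom_is_full.inducts)
    case (full_0 p B q)
    then show ?case by (auto simp: src_bdry_def tgt_bdry_def)
  next
    case (full_Suc n B A a b)
    then show ?case using act_compose[of "Free (Pos B)" "Suc n" _ N \<rho> \<sigma> \<tau>] by simp
  qed auto
  with assms show ?thesis by blast
qed

lemma sphere_act_compose_ps:
  assumes "is_pos n B p" "is_pos n B q" "n \<le> N"
    and \<rho>: "\<And>k v. k \<le> N \<Longrightarrow> is_pos k B v \<Longrightarrow> \<rho> k v = act \<sigma> k (\<tau> k v)"
  shows "sphere_act \<rho> (ps (Pos B) n p q) = sphere_act \<sigma> (sphere_act \<tau> (ps (Pos B) n p q))"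
  using assms(1-3)
proof (induction n arbitrary: p q)
  case (Suc n)
  then show ?case using \<rho> pos_src by simp
qed (simp add: \<rho>)

lemma act_rename_inverse:
  assumes "is_cell C n c" "\<And>v. v \<in> closed_supp c \<Longrightarrow> s (r v) = v"
  shows "act (rename s) n (act (rename r) n c) = c"
  using assms
proof (induction rule: cell_induct)
  case (var n v)
  then show ?case by (simp add: rename_def)
next
  case (coh n B A \<tau>)
  have "act (rename s) k (act (rename r) k (\<tau> k p)) = \<tau> k p" if "is_pos k B p" for k p
    using that coh.prems by (intro coh.IH) auto
  moreover have "\<tau> k p = undefined" if "\<not> (k \<le> Suc n \<and> is_pos k B p)" for k p
    using coh.hyps(3) that by (auto elim!: is_nhom.cases)
  ultimately show ?case by (auto simp: fun_eq_iff)
qed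

section \<open>Supports of homomorphisms\<close>

definition hom_supp :: "tree \<Rightarrow> chom \<Rightarrow> pos set" where
  "hom_supp B f = (\<Union>q\<in>tree_positions B. closed_supp (f (pdim q) q))"

lemma sphere_act_trunc: "n \<le> N \<Longrightarrow> sphere_act (trunc N f) (ps X n p q) = sphere_act f (ps X n p q)"
  by (induction n arbitrary: p q) (auto simp: trunc_def)

lemma comp_hom_Free_iff:
  "f \<in> comp_hom (Free (Pos B)) C \<longleftrightarrow>
    (\<forall>n v. is_pos n B v \<longrightarrow> is_cell C n (f n v)) \<and>
    (\<forall>n v. is_pos (Suc n) B v \<longrightarrow>
      bdry C (Suc n) (f (Suc n) v) = sphere_act f (ps (Pos B) n (psrc v) (ptgt v))) \<and>
    (\<forall>n v. \<not> is_pos n B v \<longrightarrow> f n v = undefined)"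
  (is "_ \<longleftrightarrow> ?R")
proof
  assume "f \<in> comp_hom (Free (Pos B)) C"
  then have nhom: "is_nhom n (Free (Pos B)) C (trunc n f)" for n by (simp add: comp_hom_def)
  have "is_cell C n (f n v)" if "is_pos n B v" for n v
    using nhom[of n] that by (auto elim!: is_nhom.cases simp: trunc_def)
  moreover have "bdry C (Suc n) (f (Suc n) v) = sphere_act f (ps (Pos B) n (psrc v) (ptgt v))"
    if "is_pos (Suc n) B v" for n v
  proof -
    have "bdry C (Suc n) (trunc (Suc n) f (Suc n) v) =
        sphere_act (trunc (Suc n) f) (attach (Free (Pos B)) (Suc n) v)"
      using nhom[of "Suc n"] that by (auto elim!: is_nhom.cases)
    then show ?thesis by (simp add: sphere_act_trunc) (simp add: trunc_def)
  qed
  moreover have "f n v = undefined" if "\<not> is_pos n B v" for n v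
  proof -
    have "trunc n f n v = undefined" using nhom[of n] that by (auto elim!: is_nhom.cases)
    then show ?thesis by (simp add: trunc_def)
  qed
  ultimately show ?R by blast
next
  assume R: ?R
  have "is_nhom n (Free (Pos B)) C (trunc n f)" for n
  proof (rule nhom)
    show "is_cell C k (trunc n f k v)" if "k \<le> n" "v \<in> gens (Free (Pos B)) k" for k v
      using R that by (simp add: trunc_def)
    show "bdry C (Suc k) (trunc n f (Suc k) v) = sphere_act (trunc n f) (attach (Free (Pos B)) (Suc k) v)"
      if "Suc k \<le> n" "v \<in> gens (Free (Pos B)) (Suc k)" for k v
    proof -
      have "trunc n f (Suc k) v = f (Suc k) v" using that by (simp add: trunc_def)
      then show ?thesis using R that by (simp add: sphere_act_trunc)
    qed
    show "trunc n f k v = undefined" if "k > n \<or> v \<notin> gens (Free (Pos B)) k" for k v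
      using R that by (auto simp: trunc_def)
  qed
  then show "f \<in> comp_hom (Free (Pos B)) C" by (simp add: comp_hom_def)
qed

lemma hom_subtree:
  assumes f: "f \<in> comp_hom (Free (Pos B)) (Free (Pos B'))"
  obtains x where "positions x = hom_supp B f" "positions x \<subseteq> tree_positions B'"
proof -
  have cell: "is_cell (Free (Pos B')) (pdim q) (f (pdim q) q)" if "q \<in> tree_positions B" for q
    using f that by (simp add: comp_hom_Free_iff is_pos_iff)
  have "is_nhom (tdim B) (Free (Pos B)) (Free (Pos B')) (trunc (tdim B) f)"
    using f by (simp add: comp_hom_def)
  from cell_subtree(2)[OF this, rule_format, OF refl refl order.refl]
  obtain F where F: "\<And>q. q \<in> tree_positions B \<Longrightarrow>
      positions (F q) = closed_supp (trunc (tdim B) f (pdim q) q)"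
    and face: "\<And>q k e. q \<in> tree_positions B \<Longrightarrow> pdim q = Suc k \<Longrightarrow> boundary e k (F q) = F (face e q)"
    by blast
  have F: "positions (F q) = closed_supp (f (pdim q) q)" if "q \<in> tree_positions B" for q
    using F[OF that] is_pos_le_tdim[of "pdim q" B q] that by (simp add: trunc_def is_pos_iff)
  have supp: "closed_supp (f (pdim q) q) \<subseteq> {p \<in> tree_positions B'. pdim p \<le> pdim q}"
    if "q \<in> tree_positions B" for q
    using closed_supp_dim(1)[OF cell[OF that]] .
  have "\<exists>x. positions x = (\<Union>q\<in>tree_positions B. positions (F q)) \<and>
    (\<forall>e k. positions (boundary e (k + 0) x) =
      (\<Union>q\<in>positions (boundary e k (whole B)). positions (F q)))"
  proof (rule pasting)
    show "pdim p \<le> pdim q + 0" if "q \<in> tree_positions B" "p \<in> positions (F q)" for p q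
      using supp F that by fastforce
  qed (use face in simp)
  then obtain x where "positions x = (\<Union>q\<in>tree_positions B. positions (F q))" by blast
  then have x: "positions x = hom_supp B f" using F by (simp add: hom_supp_def)
  moreover have "hom_supp B f \<subseteq> tree_positions B'" using supp by (auto simp: hom_supp_def)
  ultimately show thesis using that by simp
qed

lemma act_subtree_map:
  assumes "is_cell (Free (Pos (shape x))) n c"
  shows "act (Free_map (Pos (shape x)) (subtree_map x)) n c = act (rename (\<lambda>p. embed_pos p x)) n c"
  using assms by (rule act_cong) (simp add: Free_map_def subtree_map_def rename_def)

text \<open>
  For a generator \<open>v\<close>, both the image of the globe of \<open>v\<close> and the globe of the image of \<open>v\<close> are closed
  under faces, and the globe of a position is the smallest such set containing it.
\<close>

lemma closed_supp_rename_embed: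
  assumes "is_cell (Free (Pos (shape x))) n c"
  shows "closed_supp (act (rename (\<lambda>p. embed_pos p x)) n c) = (\<lambda>p. embed_pos p x) ` closed_supp c"
  using assms
proof (induction rule: cell_induct)
  case (var n v)
  let ?e = "\<lambda>p. embed_pos p x"
  have v: "v \<in> tree_positions (shape x)" using var by (simp add: is_pos_iff)
  have sub: "positions (globe v) \<subseteq> tree_positions (shape x)"
    using v by (intro globe_subset face_closed_tree_positions)
  have "face_closed (?e ` positions (globe v))"
    unfolding face_closed_def
  proof (intro ballI allI impI)
    fix p e assume "p \<in> ?e ` positions (globe v)" "0 < pdim p"
    then obtain q where q: "q \<in> positions (globe v)" "p = ?e q" "0 < pdim q" using sub by auto
    then have "face e p = ?e (face e q)" using sub face_embed[of q x e] by auto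
    then show "face e p \<in> ?e ` positions (globe v)" using q face_in_positions by blast
  qed
  then have "positions (globe (?e v)) \<subseteq> ?e ` positions (globe v)"
    by (rule globe_subset) simp
  moreover have "positions (globe v) \<subseteq> {p \<in> tree_positions (shape x). ?e p \<in> positions (globe (?e v))}"
  proof (rule globe_subset)
    show "face_closed {p \<in> tree_positions (shape x). ?e p \<in> positions (globe (?e v))}"
      unfolding face_closed_def
    proof (intro ballI allI impI)
      fix p e assume p: "p \<in> {p \<in> tree_positions (shape x). ?e p \<in> positions (globe (?e v))}" "0 < pdim p"
      then have "face e (?e p) \<in> positions (globe (?e v))"
        by (intro face_in_positions) auto
      then show "face e p \<in> {p \<in> tree_positions (shape x). ?e p \<in> positions (globe (?e v))}"
        using p face_embed[of p x e] face_closedD[OF face_closed_tree_positions] by auto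
    qed
  qed (use v in simp)
  ultimately show ?case by (auto simp: rename_def)
next
  case (coh n B A \<tau>)
  have le: "k \<le> Suc n" if "is_pos k B p" for k p
    using is_pos_le_tdim[OF that] coh by simp
  then have "closed_supp (act (rename (\<lambda>p. embed_pos p x)) (Suc n) (Coh B A \<tau>)) =
      (\<Union>k. \<Union>p\<in>cells (Pos B) k. closed_supp (act (rename (\<lambda>p. embed_pos p x)) k (\<tau> k p)))"
    by auto
  then show ?case using coh.IH by auto
qed

lemma hom_supp_comp_immersion:
  assumes "c \<in> comp_hom (Free (Pos B)) (Free (Pos (shape x)))"
  shows "hom_supp B (comp_compose (Free (Pos B)) (Free_map (Pos (shape x)) (subtree_map x)) c) =
    (\<lambda>p. embed_pos p x) ` hom_supp B c"
  using assms
  by (auto simp: hom_supp_def comp_compose_def comp_hom_Free_iff is_pos_iff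
      act_subtree_map closed_supp_rename_embed)

section \<open>Retraction onto a subtree\<close>

definition retract :: "subtree \<Rightarrow> pos \<Rightarrow> pos" where
  "retract x = inv_into (tree_positions (shape x)) (\<lambda>p. embed_pos p x)"

lemma embed_retract: "p \<in> positions x \<Longrightarrow> embed_pos (retract x p) x = p"
  unfolding retract_def image_embed[symmetric] by (rule f_inv_into_f)

lemma retract_embed: "p \<in> tree_positions (shape x) \<Longrightarrow> retract x (embed_pos p x) = p"
  unfolding retract_def by (rule inv_into_f_f[OF inj_on_embed])

lemma retract_in_shape:
  assumes "p \<in> positions x"
  shows "retract x p \<in> tree_positions (shape x)" "pdim (retract x p) = pdim p"
proof -
  show *: "retract x p \<in> tree_positions (shape x)"
    unfolding retract_def using assms by (intro inv_into_into) (simp add: image_embed)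
  show "pdim (retract x p) = pdim p"
    using pdim_embed[OF *] embed_retract[OF assms] by simp
qed

lemma face_retract:
  assumes "p \<in> positions x" "0 < pdim p"
  shows "face e (retract x p) = retract x (face e p)"
proof -
  have "embed_pos (face e (retract x p)) x = face e p"
    using face_embed[of "retract x p" x e] retract_in_shape[OF assms(1)] embed_retract assms by simp
  moreover have "face e (retract x p) \<in> tree_positions (shape x)"
    using face_closedD[OF face_closed_tree_positions] retract_in_shape[OF assms(1)] assms(2) by simp
  ultimately show ?thesis using retract_embed by metis
qed

text \<open>
  The trees \<open>B\<close> and \<open>D\<close> are arbitrary since the face maps of positions are the same for all trees.
\<close>

lemma sphere_act_retract_ps:
  assumes "p \<in> positions x" "pdim p = n" "q \<in> positions x" "pdim q = n"
  shows "sphere_act (rename (retract x)) (ps (Pos B) n p q) = ps (Pos D) n (retract x p) (retract x q)"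
  using assms
proof (induction n arbitrary: p q)
  case (Suc n)
  have "psrc p \<in> positions x" "ptgt p \<in> positions x" "pdim (psrc p) = n" "pdim (ptgt p) = n"
    using face_in_positions[OF Suc.prems(1), of True] face_in_positions[OF Suc.prems(1), of False]
      pdim_face[OF Suc.prems(2), of True] pdim_face[OF Suc.prems(2), of False] Suc.prems(2)
    by (simp_all add: face_def)
  moreover have "psrc (retract x p) = retract x (psrc p)" "ptgt (retract x p) = retract x (ptgt p)"
    using face_retract[OF Suc.prems(1), of True] face_retract[OF Suc.prems(1), of False] Suc.prems(2)
    by (simp_all add: face_def)
  ultimately show ?case using Suc by (simp add: rename_def)
qed (simp add: rename_def)

text \<open>
  The retraction is not a homomorphism, since it makes sense only on generators in the subtree. But
  these are the only ones that occur in the cell or in its boundary, and on them it commutes with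
  faces.
\<close>

lemma retract_cell:
  assumes "is_cell (Free (Pos B)) n c" "closed_supp c \<subseteq> positions x"
  shows "is_cell (Free (Pos (shape x))) n (act (rename (retract x)) n c)"
    and "bdry (Free (Pos (shape x))) n (act (rename (retract x)) n c) =
      sphere_act (rename (retract x)) (bdry (Free (Pos B)) n c)"
proof -
  let ?r = "rename (retract x)" and ?D = "Free (Pos (shape x))"
  have "is_cell ?D n (act ?r n c) \<and> bdry ?D n (act ?r n c) = sphere_act ?r (bdry (Free (Pos B)) n c)"
    using assms
  proof (induction rule: cell_induct)
    case (var n v)
    then have "positions (globe v) \<subseteq> positions x" "is_pos n B v" by simp_all
    then have v: "v \<in> positions x" "pdim v = n" by (auto simp: is_pos_iff)
    have "is_cell ?D n (act ?r n (Var v))"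
      using retract_in_shape[OF v(1)] v(2)
      by (auto simp: rename_def is_pos_iff intro!: is_cell_is_nhom_is_full.var)
    moreover have "bdry ?D n (act ?r n (Var v)) = sphere_act ?r (bdry (Free (Pos B)) n (Var v))"
    proof (cases n)
      case (Suc m)
      have m: "pdim v = Suc m" using v Suc by simp
      have "psrc v \<in> positions x" "ptgt v \<in> positions x" "pdim (psrc v) = m" "pdim (ptgt v) = m"
        using face_in_positions[OF v(1), of True] face_in_positions[OF v(1), of False]
          pdim_face[OF m, of True] pdim_face[OF m, of False] m
        by (simp_all add: face_def)
      moreover have "psrc (retract x v) = retract x (psrc v)" "ptgt (retract x v) = retract x (ptgt v)"
        using face_retract[OF v(1), of True] face_retract[OF v(1), of False] m
        by (simp_all add: face_def)
      moreover have "act ?r n (Var v) = Var (retract x v)" by (simp add: rename_def)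
      ultimately show ?thesis using Suc by (simp add: sphere_act_retract_ps[where D = "shape x"] del: act.simps)
    qed simp
    ultimately show ?case by blast
  next
    case (coh n B1 A \<tau>)
    have le: "k \<le> Suc n" if "is_pos k B1 p" for k p
      using is_pos_le_tdim[OF that] coh by simp
    define \<rho> where "\<rho> = (\<lambda>k p. if k \<le> Suc n \<and> is_pos k B1 p then act ?r k (\<tau> k p) else undefined)"
    have IH: "is_cell ?D k (\<rho> k p) \<and> bdry ?D k (\<rho> k p) = sphere_act ?r (bdry (Free (Pos B)) k (\<tau> k p))"
      if p: "is_pos k B1 p" for k p
      using coh.IH[OF p] coh.prems p le[OF p] by (auto simp: \<rho>_def)
    have "is_nhom (Suc n) (Free (Pos B1)) ?D \<rho>"
    proof (rule nhom)
      show "is_cell ?D k (\<rho> k v)" if "v \<in> gens (Free (Pos B1)) k" for k v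
        using IH that by simp
      show "bdry ?D (Suc k) (\<rho> (Suc k) v) = sphere_act \<rho> (attach (Free (Pos B1)) (Suc k) v)"
        if "Suc k \<le> Suc n" "v \<in> gens (Free (Pos B1)) (Suc k)" for k v
      proof -
        have v: "is_pos (Suc k) B1 v" using that by simp
        have "bdry ?D (Suc k) (\<rho> (Suc k) v) = sphere_act ?r (bdry (Free (Pos B)) (Suc k) (\<tau> (Suc k) v))"
          using IH[OF v] by blast
        also have "bdry (Free (Pos B)) (Suc k) (\<tau> (Suc k) v) =
            sphere_act \<tau> (ps (Pos B1) k (psrc v) (ptgt v))"
          using coh.hyps(3) that by (auto elim!: is_nhom.cases)
        also have "sphere_act ?r \<dots> = sphere_act \<rho> (ps (Pos B1) k (psrc v) (ptgt v))"
          using pos_src[OF v refl] that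
          by (intro sphere_act_compose_ps[of _ _ _ _ "Suc n", symmetric]) (auto simp: \<rho>_def)
        finally show ?thesis by simp
      qed
      show "\<rho> k v = undefined" if "k > Suc n \<or> v \<notin> gens (Free (Pos B1)) k" for k v
        using that by (auto simp: \<rho>_def)
    qed
    then have "is_cell ?D (Suc n) (Coh B1 A \<rho>)"
      using coh.hyps by (intro is_cell_is_nhom_is_full.coh)
    moreover have "act ?r (Suc n) (Coh B1 A \<tau>) = Coh B1 A \<rho>"
      by (simp add: \<rho>_def)
    moreover have "sphere_act \<rho> A = sphere_act ?r (sphere_act \<tau> A)"
      using coh.hyps(2) by (rule sphere_act_compose_full[of _ _ _ "Suc n"]) (auto simp: \<rho>_def)
    ultimately show ?case by (simp del: act.simps)
  qed
  then show "is_cell ?D n (act ?r n c)"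
    and "bdry ?D n (act ?r n c) = sphere_act ?r (bdry (Free (Pos B)) n c)" by auto
qed

text \<open>
  The factor is obtained by applying the retraction to all values of \<open>f\<close>.
\<close>

lemma factor_through_subtree:
  assumes f: "f \<in> comp_hom (Free (Pos B)) (Free (Pos B'))" and x: "hom_supp B f \<subseteq> positions x"
  obtains c where "c \<in> comp_hom (Free (Pos B)) (Free (Pos (shape x)))"
    "f = comp_compose (Free (Pos B)) (Free_map (Pos (shape x)) (subtree_map x)) c"
proof
  let ?r = "rename (retract x)" and ?D = "Free (Pos (shape x))"
  let ?c = "\<lambda>n v. if is_pos n B v then act ?r n (f n v) else undefined"
  have cell: "is_cell (Free (Pos B')) n (f n v)" if "is_pos n B v" for n v
    using f that by (simp add: comp_hom_Free_iff)
  have supp: "closed_supp (f n v) \<subseteq> positions x" if "is_pos n B v" for n v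
    using x that by (auto simp: hom_supp_def is_pos_iff)
  note c = retract_cell[OF cell supp]
  have "bdry ?D (Suc n) (?c (Suc n) v) = sphere_act ?c (ps (Pos B) n (psrc v) (ptgt v))"
    if v: "is_pos (Suc n) B v" for n v
  proof -
    have "bdry ?D (Suc n) (?c (Suc n) v) = sphere_act ?r (bdry (Free (Pos B')) (Suc n) (f (Suc n) v))"
      using c(2)[OF v v] v by simp
    also have "\<dots> = sphere_act ?r (sphere_act f (ps (Pos B) n (psrc v) (ptgt v)))"
      using f v by (simp add: comp_hom_Free_iff)
    also have "\<dots> = sphere_act ?c (ps (Pos B) n (psrc v) (ptgt v))"
      using pos_src[OF v refl] by (intro sphere_act_compose_ps[of _ _ _ _ n, symmetric]) auto
    finally show ?thesis .
  qed
  then show "?c \<in> comp_hom (Free (Pos B)) ?D"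
    using c(1) by (simp add: comp_hom_Free_iff)
  show "f = comp_compose (Free (Pos B)) (Free_map (Pos (shape x)) (subtree_map x)) ?c"
  proof (intro ext)
    fix n v
    show "f n v = comp_compose (Free (Pos B)) (Free_map (Pos (shape x)) (subtree_map x)) ?c n v"
    proof (cases "is_pos n B v")
      case True
      have "act (rename (\<lambda>p. embed_pos p x)) n (act ?r n (f n v)) = f n v"
        using cell[OF True] by (rule act_rename_inverse) (use supp[OF True] embed_retract in blast)
      then show ?thesis
        using True act_subtree_map[OF c(1)[OF True True]] by (simp add: comp_compose_def)
    next
      case False
      then show ?thesis using f by (simp add: comp_compose_def comp_hom_Free_iff)
    qed
  qed
qed

section \<open>Covers and the factorisation\<close>

lemma hom_supp_subset:
  assumes "f \<in> comp_hom (Free (Pos B)) (Free (Pos B'))"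
  shows "hom_supp B f \<subseteq> tree_positions B'"
  using hom_subtree[OF assms] by blast

lemma Free_map_subtree_map_eq_id:
  assumes "shape x = B"
  shows "Free_map (Pos B) (subtree_map x) = comp_id (Free (Pos B)) \<longleftrightarrow> x = whole B"
proof
  assume eq: "Free_map (Pos B) (subtree_map x) = comp_id (Free (Pos B))"
  have "embed_pos p x = p" if "p \<in> tree_positions B" for p
    using fun_cong[OF fun_cong[OF eq], of "pdim p" p] that assms
    by (simp add: Free_map_def comp_id_def subtree_map_def is_pos_iff)
  then have "(\<lambda>p. embed_pos p x) ` tree_positions B = positions (whole B)"
    by (simp add: positions_whole)
  then have "positions x = positions (whole B)"
    using image_embed[of x] assms by simp
  then show "x = whole B" by (simp add: positions_inject)
next
  assume "x = whole B"
  then show "Free_map (Pos B) (subtree_map x) = comp_id (Free (Pos B))"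
    by (auto simp: Free_map_def comp_id_def subtree_map_def is_pos_iff embed_whole fun_eq_iff)
qed

lemma Theta_w_simps [simp]:
  "hom Theta_w B B' = comp_hom (Free (Pos B)) (Free (Pos B'))"
  "idm Theta_w B = comp_id (Free (Pos B))"
  "cmp Theta_w B D B' g f = comp_compose (Free (Pos B)) g f"
  by (simp_all add: Theta_w_def)

lemma immersion_iff:
  "immersion Theta_w D B i \<longleftrightarrow>
    (\<exists>x. shape x = D \<and> positions x \<subseteq> tree_positions B \<and> i = Free_map (Pos D) (subtree_map x))"
proof
  assume "immersion Theta_w D B i"
  then obtain g where "g \<in> Theta0 D B" "i = Free_map (Pos D) g"
    by (auto simp: immersion_def Theta_w_def)
  then show "\<exists>x. shape x = D \<and> positions x \<subseteq> tree_positions B \<and> i = Free_map (Pos D) (subtree_map x)"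
    using Theta0_subtree_map by metis
next
  assume "\<exists>x. shape x = D \<and> positions x \<subseteq> tree_positions B \<and> i = Free_map (Pos D) (subtree_map x)"
  then show "immersion Theta_w D B i"
    using subtree_map_in_Theta0 by (auto simp: immersion_def Theta_w_def)
qed

text \<open>
  If \<open>c\<close> is a cover, factoring it through its own support forces that subtree to be everything.
  Conversely, an immersion through which \<open>c\<close> factors contains the support of \<open>c\<close>.
\<close>

lemma cover_iff:
  "cover Theta_w B D c \<longleftrightarrow>
    c \<in> comp_hom (Free (Pos B)) (Free (Pos D)) \<and> hom_supp B c = tree_positions D"
proof
  assume "cover Theta_w B D c"
  then have c: "c \<in> comp_hom (Free (Pos B)) (Free (Pos D))"
    and cover: "\<And>E i g. immersion Theta_w E D i \<Longrightarrow> g \<in> comp_hom (Free (Pos B)) (Free (Pos E)) \<Longrightarrow>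
      c = comp_compose (Free (Pos B)) i g \<Longrightarrow> E = D \<and> i = comp_id (Free (Pos D))"
    by (auto simp: cover_def)
  obtain x where x: "positions x = hom_supp B c" "positions x \<subseteq> tree_positions D"
    using hom_subtree[OF c] .
  obtain g where "g \<in> comp_hom (Free (Pos B)) (Free (Pos (shape x)))"
    "c = comp_compose (Free (Pos B)) (Free_map (Pos (shape x)) (subtree_map x)) g"
    using factor_through_subtree[OF c, of x] x(1) by blast
  then have "shape x = D \<and> Free_map (Pos (shape x)) (subtree_map x) = comp_id (Free (Pos D))"
    using x(2) by (intro cover) (auto simp: immersion_iff)
  then have "x = whole D" using Free_map_subtree_map_eq_id by auto
  with c x(1) show "c \<in> comp_hom (Free (Pos B)) (Free (Pos D)) \<and> hom_supp B c = tree_positions D"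
    by (simp add: positions_whole)
next
  assume c: "c \<in> comp_hom (Free (Pos B)) (Free (Pos D)) \<and> hom_supp B c = tree_positions D"
  have "E = D \<and> i = comp_id (Free (Pos D))"
    if i: "immersion Theta_w E D i" and g: "g \<in> comp_hom (Free (Pos B)) (Free (Pos E))"
      and eq: "c = comp_compose (Free (Pos B)) i g" for E i g
  proof -
    obtain x where x: "shape x = E" "positions x \<subseteq> tree_positions D"
      and i: "i = Free_map (Pos (shape x)) (subtree_map x)"
      using i by (auto simp: immersion_iff)
    have "hom_supp B c = (\<lambda>p. embed_pos p x) ` hom_supp B g"
      unfolding eq i using g x by (intro hom_supp_comp_immersion) simp
    also have "\<dots> \<subseteq> positions x"
      using hom_supp_subset[OF g] x(1) embed_in_positions by blast
    finally have "positions x = positions (whole D)" using c x(2) by (simp add: positions_whole)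
    then have "x = whole D" by (simp add: positions_inject)
    with x i show ?thesis using Free_map_subtree_map_eq_id[of x D] by simp
  qed
  with c show "cover Theta_w B D c" by (auto simp: cover_def)
qed

text \<open>
  Immersions are monomorphisms: the retraction of generators recovers each cell from its image.
\<close>

lemma comp_immersion_cancel:
  assumes "c \<in> comp_hom (Free (Pos B)) (Free (Pos (shape x)))"
    and "c' \<in> comp_hom (Free (Pos B)) (Free (Pos (shape x)))"
    and eq: "comp_compose (Free (Pos B)) (Free_map (Pos (shape x)) (subtree_map x)) c =
      comp_compose (Free (Pos B)) (Free_map (Pos (shape x)) (subtree_map x)) c'"
  shows "c = c'"
proof (intro ext)
  fix n v
  show "c n v = c' n v"
  proof (cases "is_pos n B v")
    case True
    let ?e = "rename (\<lambda>p. embed_pos p x)" and ?r = "rename (retract x)"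
    have cells: "is_cell (Free (Pos (shape x))) n (c n v)" "is_cell (Free (Pos (shape x))) n (c' n v)"
      using assms(1,2) True by (simp_all add: comp_hom_Free_iff)
    have inv: "act ?r n (act ?e n a) = a" if "is_cell (Free (Pos (shape x))) n a" for a
      using that by (rule act_rename_inverse) (use closed_supp_dim(1)[OF that] retract_embed in blast)
    have "act ?e n (c n v) = act ?e n (c' n v)"
      using fun_cong[OF fun_cong[OF eq], of n v] True cells
      by (simp add: comp_compose_def act_subtree_map)
    then show ?thesis using inv[OF cells(1)] inv[OF cells(2)] by metis
  next
    case False
    then show ?thesis using assms(1,2) by (simp add: comp_hom_Free_iff)
  qed
qed

theorem proposition7p27:
  fixes B B' :: tree and f :: chom
  assumes "f \<in> hom Theta_w B B'"
  shows "\<exists>!(D, i, c). immersion Theta_w D B' i \<and> cover Theta_w B D c \<and> f = cmp Theta_w B D B' i c"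
proof -
  let ?i = "\<lambda>x. Free_map (Pos (shape x)) (subtree_map x)"
  have f: "f \<in> comp_hom (Free (Pos B)) (Free (Pos B'))" using assms by simp
  obtain x where x: "positions x = hom_supp B f" "positions x \<subseteq> tree_positions B'"
    using hom_subtree[OF f] .
  obtain c where c: "c \<in> comp_hom (Free (Pos B)) (Free (Pos (shape x)))"
    and fc: "f = comp_compose (Free (Pos B)) (?i x) c"
    using factor_through_subtree[OF f, of x] x(1) by blast
  have "(\<lambda>p. embed_pos p x) ` hom_supp B c = (\<lambda>p. embed_pos p x) ` tree_positions (shape x)"
    using hom_supp_comp_immersion[OF c] x(1) unfolding image_embed fc[symmetric] by simp
  then have "hom_supp B c = tree_positions (shape x)"
    using inj_on_image_eq_iff[OF inj_on_embed hom_supp_subset[OF c] order.refl] by blast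
  then have cover: "cover Theta_w B (shape x) c" using c by (simp add: cover_iff)
  have unique: "D = shape x \<and> i = ?i x \<and> c' = c"
    if i: "immersion Theta_w D B' i" and cover: "cover Theta_w B D c'"
      and eq: "f = comp_compose (Free (Pos B)) i c'" for D i c'
  proof -
    obtain y where y: "shape y = D" "i = ?i y"
      using i unfolding immersion_iff by metis
    have c': "c' \<in> comp_hom (Free (Pos B)) (Free (Pos (shape y)))"
      "hom_supp B c' = tree_positions (shape y)"
      using cover y(1) by (simp_all add: cover_iff)
    have "hom_supp B f = positions y"
      using hom_supp_comp_immersion[OF c'(1)] c'(2) eq y(2) by (simp add: image_embed)
    then have "y = x" using x(1) by (simp flip: positions_inject)
    moreover from this have "c' = c"
      using comp_immersion_cancel[of c' B x c] c'(1) c fc eq y(2) by metis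
    ultimately show ?thesis using y by simp
  qed
  show ?thesis
  proof (rule ex1I[of _ "(shape x, ?i x, c)"])
    show "case (shape x, ?i x, c) of (D, i, c) \<Rightarrow>
      immersion Theta_w D B' i \<and> cover Theta_w B D c \<and> f = cmp Theta_w B D B' i c"
      using x(2) cover fc by (auto simp: immersion_iff)
    fix t
    assume t: "case t of (D, i, c) \<Rightarrow>
      immersion Theta_w D B' i \<and> cover Theta_w B D c \<and> f = cmp Theta_w B D B' i c"
    obtain D i c' where "t = (D, i, c')" by (cases t)
    with t unique[of D i c'] show "t = (shape x, ?i x, c)" by simp
  qed
qed

end
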